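(* Let $r\geq 2$ be an integer, let $n>r^{15}$, and let $G$ be a graph of order $n$. If $\mu(G)>\mu(T_r(n))$, then $js_{r+1}(G)>n^{r-1}/r^{2r+4}$.
   Context: All graphs are finite and simple. For a graph $G$, $\mu(G)$ denotes the largest eigenvalue of the adjacency matrix of $G$. $T_r(n)$ is the $r$-partite Turán graph of order $n$, i.e. the complete $r$-partite graph on $n$ vertices whose part sizes differ by at most one. For an integer $k\ge 2$, a $k$-joint of size $t$ is the union of $t$ distinct $k$-cliques (complete subgraphs on $k$ vertices) all sharing a common edge; $js_k(G)$ denotes the maximum size of a $k$-joint contained in $G$. *)

theory Defs
  imports "Graph_Theory.Graph_Theory" "Jordan_Normal_Form.Spectral_Radius"
begin

text \<open>
  Finite simple graphs are the library's \<^locale>\<open>graph\<close>: finite, loop-free, symmetric digraphs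
  without parallel arcs. An undirected edge $uv$ is the pair of opposite arcs between $u$ and $v$.
\<close>

definition adjacency_mat :: "('a, 'b) pre_digraph \<Rightarrow> 'a list \<Rightarrow> real mat" where
  "adjacency_mat G vs =
     mat (length vs) (length vs) (\<lambda>(i, j). if dominates G (vs ! i) (vs ! j) then 1 else 0)"

text \<open>
  The ordering of the vertices is irrelevant, see \<open>mu_eq_enumeration\<close> below. The spectrum is taken
  over the reals, which is no restriction because the adjacency matrix of a graph is symmetric.
\<close>

definition mu :: "('a, 'b) pre_digraph \<Rightarrow> real" where
  "mu G = Max (spectrum (adjacency_mat G (SOME vs. distinct vs \<and> set vs = verts G)))"

text \<open>
  The parts are the residue classes modulo $r$, see \<open>turan_graph_complete_multipartite\<close> and
  \<open>turan_graph_balanced\<close> below.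
\<close>

definition turan_graph :: "nat \<Rightarrow> nat \<Rightarrow> (nat, nat \<times> nat) pre_digraph" where
  "turan_graph r n = with_proj
     \<lparr> pverts = {..<n}, parcs = {(u, v). u < n \<and> v < n \<and> u mod r \<noteq> v mod r} \<rparr>"

definition k_cliques :: "nat \<Rightarrow> ('a, 'b) pre_digraph \<Rightarrow> ('a, 'b) pre_digraph set" where
  "k_cliques k G = {H. subgraph H G \<and> complete_digraph k H}"

text \<open>
  A joint is represented by the set of cliques whose union it is; its size is the cardinality of
  this set. Note that a complete graph containing an arc also contains the opposite arc.
\<close>

definition k_joint :: "nat \<Rightarrow> ('a, 'b) pre_digraph \<Rightarrow> ('a, 'b) pre_digraph set \<Rightarrow> bool" where
  "k_joint k G C \<longleftrightarrow> C \<subseteq> k_cliques k G \<and> (\<exists>e\<in>arcs G. \<forall>H\<in>C. e \<in> arcs H)"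

text \<open>On the naturals \<^const>\<open>Sup\<close> is \<^const>\<open>Max\<close>, except that it yields 0 if there are no edges.\<close>

definition js :: "nat \<Rightarrow> ('a, 'b) pre_digraph \<Rightarrow> nat" where
  "js k G = Sup {card C | C. k_joint k G C}"


lemma eigenvalue_adjacency_mat:
  assumes "distinct vs"
  shows "eigenvalue (adjacency_mat G vs) x \<longleftrightarrow>
    (\<exists>f. (\<exists>v\<in>set vs. f v \<noteq> 0) \<and>
         (\<forall>u\<in>set vs. (\<Sum>v\<in>set vs. (if dominates G u v then 1 else 0) * f v) = x * f u))"
    (is "?L \<longleftrightarrow> ?R")
proof -
  let ?n = "length vs"
  have reix: "(\<Sum>i<?n. g (vs ! i)) = sum g (set vs)" for g :: "'a \<Rightarrow> real"
    by (rule sum.reindex_bij_betw[OF bij_betw_nth[OF assms refl refl]])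
  have mult: "(adjacency_mat G vs *\<^sub>v vec ?n (\<lambda>i. f (vs ! i))) $ i =
      (\<Sum>v\<in>set vs. (if dominates G (vs ! i) v then 1 else 0) * f v)" if "i < ?n" for f i
    using that
    by (simp add: adjacency_mat_def scalar_prod_def atLeast0LessThan reix[symmetric])
  have dims: "dim_row (adjacency_mat G vs) = ?n" "dim_col (adjacency_mat G vs) = ?n"
    by (simp_all add: adjacency_mat_def)
  have ev: "eigenvector (adjacency_mat G vs) (vec ?n (\<lambda>i. f (vs ! i))) x \<longleftrightarrow>
      (\<exists>v\<in>set vs. f v \<noteq> 0) \<and>
      (\<forall>u\<in>set vs. (\<Sum>v\<in>set vs. (if dominates G u v then 1 else 0) * f v) = x * f u)" for f
  proof -
    have "vec ?n (\<lambda>i. f (vs ! i)) \<noteq> 0\<^sub>v ?n \<longleftrightarrow> (\<exists>i<?n. f (vs ! i) \<noteq> 0)"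
      by (auto simp: vec_eq_iff)
    also have "\<dots> \<longleftrightarrow> (\<exists>v\<in>set vs. f v \<noteq> 0)"
      by (metis in_set_conv_nth)
    finally have 1: "vec ?n (\<lambda>i. f (vs ! i)) \<noteq> 0\<^sub>v ?n \<longleftrightarrow> (\<exists>v\<in>set vs. f v \<noteq> 0)" .
    have "adjacency_mat G vs *\<^sub>v vec ?n (\<lambda>i. f (vs ! i)) = x \<cdot>\<^sub>v vec ?n (\<lambda>i. f (vs ! i)) \<longleftrightarrow>
      (\<forall>i<?n. (\<Sum>v\<in>set vs. (if dominates G (vs ! i) v then 1 else 0) * f v) = x * f (vs ! i))"
      by (simp add: vec_eq_iff dims mult del: index_mult_mat_vec)
    also have "\<dots> \<longleftrightarrow>
      (\<forall>u\<in>set vs. (\<Sum>v\<in>set vs. (if dominates G u v then 1 else 0) * f v) = x * f u)"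
      by (simp only: all_set_conv_all_nth)
    finally show ?thesis using 1 unfolding eigenvector_def dims by simp
  qed
  show ?thesis
  proof
    assume ?L
    then obtain w where w: "eigenvector (adjacency_mat G vs) w x"
      by (auto simp: eigenvalue_def)
    define f where "f = (\<lambda>v. w $ (inv_into {..<?n} (\<lambda>i. vs ! i) v))"
    have "f (vs ! i) = w $ i" if "i < ?n" for i
      using that assms by (simp add: f_def inv_into_f_f inj_on_nth)
    moreover have "dim_vec w = ?n"
      using w dims by (auto simp: eigenvector_def)
    ultimately have "w = vec ?n (\<lambda>i. f (vs ! i))"
      by (auto simp: vec_eq_iff)
    then show ?R using w ev[of f] by (intro exI[of _ f]) simp
  next
    assume ?R
    then obtain f where "eigenvector (adjacency_mat G vs) (vec ?n (\<lambda>i. f (vs ! i))) x"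
      unfolding ev[symmetric] by (rule exE)
    then show ?L unfolding eigenvalue_def by (rule exI)
  qed
qed

lemma mu_eq_enumeration:
  assumes "distinct vs" "set vs = verts G"
  shows "mu G = Max (spectrum (adjacency_mat G vs))"
proof -
  let ?ws = "SOME vs. distinct vs \<and> set vs = verts G"
  have "distinct ?ws \<and> set ?ws = verts G"
    by (rule someI[where P = "\<lambda>vs. distinct vs \<and> set vs = verts G"]) (use assms in simp)
  then have "spectrum (adjacency_mat G ?ws) = spectrum (adjacency_mat G vs)"
    using assms unfolding spectrum_def by (intro Collect_cong) (simp add: eigenvalue_adjacency_mat)
  then show ?thesis by (simp add: mu_def)
qed

lemma graph_turan_graph: "graph (turan_graph r n)"
proof -
  have "finite {(u, v). u < n \<and> v < n \<and> u mod r \<noteq> v mod r}"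
    by (rule finite_subset[of _ "{..<n} \<times> {..<n}"]) auto
  then show ?thesis
    by unfold_locales
      (auto simp: turan_graph_def arc_to_ends_def symmetric_def intro!: symI)
qed

lemma turan_graph_complete_multipartite:
  "verts (turan_graph r n) = {..<n}"
  "dominates (turan_graph r n) u v \<longleftrightarrow> u < n \<and> v < n \<and> u mod r \<noteq> v mod r"
  by (auto simp: turan_graph_def)

lemma turan_graph_balanced:
  assumes "i < r"
  shows "card {v \<in> verts (turan_graph r n). v mod r = i} \<in> {n div r, n div r + 1}"
proof -
  let ?Q = "{q. q * r + i < n}"
  have "v \<in> (\<lambda>q. q * r + i) ` ?Q" if "v < n" "v mod r = i" for v
    using that by (intro image_eqI[of _ _ "v div r"]) (auto simp: div_mult_mod_eq)
  then have "{v \<in> verts (turan_graph r n). v mod r = i} = (\<lambda>q. q * r + i) ` ?Q"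
    using assms by (auto simp: turan_graph_def)
  moreover have "inj_on (\<lambda>q. q * r + i) ?Q"
    using assms by (auto simp: inj_on_def)
  ultimately have card: "card {v \<in> verts (turan_graph r n). v mod r = i} = card ?Q"
    by (simp add: card_image)
  have sub1: "{..<n div r} \<subseteq> ?Q"
  proof
    fix q assume "q \<in> {..<n div r}"
    then have "Suc q * r \<le> n div r * r" by (intro mult_right_mono) auto
    also have "\<dots> \<le> n" by simp
    finally show "q \<in> ?Q" using assms by simp
  qed
  have sub2: "?Q \<subseteq> {..n div r}"
  proof
    fix q assume "q \<in> ?Q"
    then have "q * r \<le> n" by simp
    then show "q \<in> {..n div r}"
      using assms by (simp add: less_eq_div_iff_mult_less_eq)
  qed
  have "n div r \<le> card ?Q" "card ?Q \<le> n div r + 1"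
    using card_mono[OF finite_subset[OF sub2] sub1] card_mono[OF _ sub2] by simp_all
  then show ?thesis unfolding card by auto
qed

end

theory Submission
  imports Defs "HOL-Analysis.Function_Topology" "HOL-Analysis.Convex"
begin

text \<open>
  Write $g = 1 - 1/r$, $a = r^{-4}$ and $c = g(1 - a)$, and let $t$ be the largest number of
  $(r+1)$-cliques on an edge. Among the induced subgraphs on at least half of the vertices choose
  $H$, of order $m$, maximising $\mu(H) - c\,|H|$. As $\mu(T_r(n)) \ge g n - r/(4n)$, the choice of
  $H$ gives $\mu(H) > g m + g a (n - m) - r/(4n)$.

  If $H$ has the minimal admissible order, then $\mu(H) \ge (g + h) m$ with $h = 3 g a / 4$. Weight
  the vertices by the Perron vector $x$, normalised to $p = x / \sum x$. The weighted edge density is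
  at least $\mu(H)/m$, so the Moon-Moser inequalities bound the weighted number of $(r+1)$-cliques
  from below; as $p \le 1/\mu(H)$ pointwise, this bounds $t$ from below.

  Otherwise deleting a vertex $v$ lowers $\mu$ by at least $c$, which forces
  $x_v^2 \ge c/(\mu + c)$ for the unit Perron vector and hence minimum degree at least
  $(g - a) m$. Moreover $H$ contains an $(r+1)$-clique: if $H = G$ by the spectral Turan theorem,
  and otherwise because $\mu(H) > g m$. Some edge of this clique has codegree exceeding $(1 - 2/r) m$
  by enough that the greedy extension to $(r+1)$-cliques never gets stuck.
\<close>

section \<open>The largest eigenvalue as a maximal Rayleigh quotient\<close>

text \<open>The hypothesis may exceed the Turan value by an arbitrarily small amount, so
  \<open>G\<close> itself offers neither a density surplus for clique counting nor a minimum degree.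
  The slope c, slightly below g, trades one for the other: each vertex removed without loss of
  potential adds g a to \<mu> - g m. Either about half of the vertices go, and the surplus reaches
  the order of g a m, or the removal stops early and every remaining vertex carries its share of the
  Perron vector. The size of a comes from the greedy extension. If all degrees equal g m, averaging
  over the edges of an (r+1)-clique gives an edge of codegree at least (1 - 2/r) m + 2 m/(r^2
  (r+1)). A degree deficit of a m costs about r a m until an r-clique is reached, so a can only be
  of order r^(-4).\<close>

locale adjacency =
  fixes E :: "'a \<Rightarrow> 'a \<Rightarrow> bool"
  assumes sym: "E u v \<Longrightarrow> E v u" and irrefl: "\<not> E u u"
begin

definition nbrs :: "'a set \<Rightarrow> 'a \<Rightarrow> 'a set" where
  "nbrs S u = {v \<in> S. E u v}"

definition quad :: "'a set \<Rightarrow> ('a \<Rightarrow> real) \<Rightarrow> real" where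
  "quad S x = (\<Sum>u\<in>S. x u * (\<Sum>v\<in>nbrs S u. x v))"

text \<open>The vertex set is an argument throughout, so the subgraph induced on \<open>S\<close> is
  treated without building a new graph. \<open>mu_eq_lam\<close> identifies this supremum with the
  largest eigenvalue.\<close>

definition lam :: "'a set \<Rightarrow> real" where
  "lam S = Sup (quad S ` {x. (\<Sum>u\<in>S. (x u)\<^sup>2) = 1})"

lemma nbrs_subset: "nbrs S u \<subseteq> S"
  by (auto simp: nbrs_def)

lemma finite_nbrs: "finite S \<Longrightarrow> finite (nbrs S u)"
  by (simp add: nbrs_def)

lemma mem_nbrs: "v \<in> nbrs S u \<longleftrightarrow> v \<in> S \<and> E u v"
  by (simp add: nbrs_def)

lemma E_commute: "E u v \<longleftrightarrow> E v u"
  using sym by blast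

lemma sum_nbrs: "finite S \<Longrightarrow> (\<Sum>v\<in>nbrs S u. f v) = (\<Sum>v\<in>S. if E u v then f v else (0::real))"
  unfolding nbrs_def by (rule sum.inter_filter)

text \<open>Self-adjointness of the adjacency operator; it merges the two cross terms in
  \<open>quad_add\<close>.\<close>

lemma sum_nbrs_swap:
  assumes "finite S"
  shows "(\<Sum>u\<in>S. f u * (\<Sum>v\<in>nbrs S u. g v)) = (\<Sum>u\<in>S. g u * (\<Sum>v\<in>nbrs S u. f v :: real))"
proof -
  have "(\<Sum>u\<in>S. f u * (\<Sum>v\<in>nbrs S u. g v)) = (\<Sum>u\<in>S. \<Sum>v\<in>S. if E u v then f u * g v else 0)"
    using assms by (simp add: sum_nbrs sum_distrib_left if_distrib cong: if_cong)
  also have "\<dots> = (\<Sum>v\<in>S. \<Sum>u\<in>S. if E u v then f u * g v else 0)"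
    by (rule sum.swap)
  also have "\<dots> = (\<Sum>u\<in>S. g u * (\<Sum>v\<in>nbrs S u. f v))"
    using assms by (simp add: sum_nbrs sum_distrib_left if_distrib E_commute mult.commute cong: if_cong)
  finally show ?thesis .
qed

lemma quad_cong: "(\<And>u. u \<in> S \<Longrightarrow> x u = y u) \<Longrightarrow> quad S x = quad S y"
  unfolding quad_def using nbrs_subset by (intro sum.cong arg_cong2[where f = "(*)"]) auto

lemma quad_scale: "quad S (\<lambda>u. a * x u) = a\<^sup>2 * quad S x"
  by (simp add: quad_def sum_distrib_left[symmetric] power2_eq_square mult.assoc mult.left_commute)

lemma quad_abs: "quad S x \<le> quad S (\<lambda>u. \<bar>x u\<bar>)"
  unfolding quad_def
proof (rule sum_mono)
  fix u
  have "x u * (\<Sum>v\<in>nbrs S u. x v) \<le> \<bar>x u\<bar> * \<bar>\<Sum>v\<in>nbrs S u. x v\<bar>"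
    by (metis abs_ge_self abs_mult)
  also have "\<dots> \<le> \<bar>x u\<bar> * (\<Sum>v\<in>nbrs S u. \<bar>x v\<bar>)"
    by (intro mult_left_mono sum_abs) auto
  finally show "x u * (\<Sum>v\<in>nbrs S u. x v) \<le> \<bar>x u\<bar> * (\<Sum>v\<in>nbrs S u. \<bar>x v\<bar>)" .
qed

lemma quad_add:
  assumes "finite S"
  shows "quad S (\<lambda>u. x u + y u) = quad S x + 2 * (\<Sum>u\<in>S. y u * (\<Sum>v\<in>nbrs S u. x v)) + quad S y"
  using sum_nbrs_swap[OF assms, of x y]
  by (simp add: quad_def sum.distrib algebra_simps)

lemma quad_single:
  assumes "finite S" "w \<in> S"
  shows "quad S (\<lambda>u. if u = w then t else 0) = 0"
proof -
  have "(if u = w then t else 0) * (\<Sum>v\<in>nbrs S u. if v = w then t else 0) = 0" for u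
    using irrefl assms by (auto simp: finite_nbrs mem_nbrs)
  then show ?thesis unfolding quad_def by (intro sum.neutral) auto
qed

text \<open>Coordinates outside \<open>S\<close> are unconstrained, so the unit sphere in the full
  function space may fail to be compact. It is cut by the box \<open>B\<close>, which pins those
  coordinates to 0 and is compact by Tychonoff; \<open>quad\<close> only sees the coordinates in
  \<open>S\<close>, so nothing is lost.\<close>

lemma quad_attains_max:
  assumes "finite S" "S \<noteq> {}"
  obtains x where "(\<Sum>u\<in>S. (x u)\<^sup>2) = 1"
    "\<And>y. (\<Sum>u\<in>S. (y u)\<^sup>2) = 1 \<Longrightarrow> quad S y \<le> quad S x"
proof -
  define B where "B = PiE UNIV (\<lambda>u. if u \<in> S then {-1..1::real} else {0})"
  define K where "K = B \<inter> {x. (\<Sum>u\<in>S. (x u)\<^sup>2) = 1}"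
  have coord: "continuous_on T (\<lambda>x::'a \<Rightarrow> real. x u)" for u T
    by (rule continuous_on_subset[OF continuous_on_product_coordinates]) auto
  have "compactin (product_topology (\<lambda>_. euclidean) UNIV) B"
    unfolding B_def compactin_PiE by auto
  then have "compact B"
    by (simp add: euclidean_product_topology)
  moreover have "closed {x::'a \<Rightarrow> real. (\<Sum>u\<in>S. (x u)\<^sup>2) = 1}"
    by (intro closed_Collect_eq continuous_intros coord)
  ultimately have "compact K"
    unfolding K_def by (rule compact_Int_closed)
  obtain w where "w \<in> S" using assms by blast
  have "(\<Sum>u\<in>S. (if u = w then 1 else 0 :: real)\<^sup>2) = (\<Sum>u\<in>S. if u = w then 1 else 0)"
    by (intro sum.cong) auto
  also have "\<dots> = 1" using assms \<open>w \<in> S\<close> by simp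
  finally have "(\<lambda>u. if u = w then 1 else 0) \<in> K"
    using \<open>w \<in> S\<close> by (auto simp: K_def B_def)
  then have "K \<noteq> {}" by blast
  have "continuous_on K (quad S)"
    unfolding quad_def by (intro continuous_intros coord)
  then obtain x where x: "x \<in> K" "\<forall>y\<in>K. quad S y \<le> quad S x"
    using continuous_attains_sup[OF \<open>compact K\<close> \<open>K \<noteq> {}\<close>] by blast
  show thesis
  proof (rule that)
    show "(\<Sum>u\<in>S. (x u)\<^sup>2) = 1" using x by (simp add: K_def)
    fix y :: "'a \<Rightarrow> real" assume y: "(\<Sum>u\<in>S. (y u)\<^sup>2) = 1"
    define z where "z = (\<lambda>u. if u \<in> S then y u else 0)"
    have "\<bar>y u\<bar> \<le> 1" if "u \<in> S" for u
    proof -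
      have "(y u)\<^sup>2 \<le> (\<Sum>u\<in>S. (y u)\<^sup>2)"
        using assms that by (intro member_le_sum) auto
      then show ?thesis using y abs_square_le_1[of "y u"] by simp
    qed
    then have "z \<in> B" by (auto simp: B_def z_def abs_le_iff minus_le_iff split: if_splits)
    moreover have "(\<Sum>u\<in>S. (z u)\<^sup>2) = 1" using y by (simp add: z_def)
    ultimately have "quad S z \<le> quad S x" using x by (simp add: K_def)
    moreover have "quad S z = quad S y" by (intro quad_cong) (simp add: z_def)
    ultimately show "quad S y \<le> quad S x" by simp
  qed
qed

lemma quad_max_eq_lam:
  assumes "(\<Sum>u\<in>S. (x u)\<^sup>2) = 1"
    "\<And>y. (\<Sum>u\<in>S. (y u)\<^sup>2) = 1 \<Longrightarrow> quad S y \<le> quad S x"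
  shows "lam S = quad S x"
  unfolding lam_def using assms by (intro cSup_eq_maximum) auto

lemma quad_le_lam:
  assumes "finite S" "S \<noteq> {}"
  shows "quad S y \<le> lam S * (\<Sum>u\<in>S. (y u)\<^sup>2)"
proof (cases "(\<Sum>u\<in>S. (y u)\<^sup>2) = 0")
  case True
  then have "\<forall>u\<in>S. y u = 0" using assms by (simp add: sum_nonneg_eq_0_iff)
  then have "quad S y = 0" by (simp add: quad_def)
  then show ?thesis using True by simp
next
  case False
  let ?N = "\<Sum>u\<in>S. (y u)\<^sup>2"
  have pos: "?N > 0" using False sum_nonneg[of S "\<lambda>u. (y u)\<^sup>2"] by (simp add: less_le)
  obtain x where x: "(\<Sum>u\<in>S. (x u)\<^sup>2) = 1"
    "\<And>y. (\<Sum>u\<in>S. (y u)\<^sup>2) = 1 \<Longrightarrow> quad S y \<le> quad S x"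
    using quad_attains_max[OF assms] by blast
  have "(\<Sum>u\<in>S. (1 / sqrt ?N * y u)\<^sup>2) = 1"
    using pos by (simp add: power_mult_distrib power_divide sum_divide_distrib[symmetric])
  then have "quad S (\<lambda>u. 1 / sqrt ?N * y u) \<le> lam S"
    using x(2) quad_max_eq_lam[OF x] by simp
  then have "(1 / sqrt ?N)\<^sup>2 * quad S y \<le> lam S"
    by (simp only: quad_scale)
  then have "quad S y / ?N \<le> lam S" using pos by (simp add: power_divide)
  then show ?thesis using pos by (simp add: field_simps)
qed

text \<open>Taking absolute values of a maximiser does not decrease \<open>quad\<close>, so there is
  a nonnegative maximiser. The eigenvalue equation at \<open>w\<close> is its first-order condition
  in the single coordinate \<open>w\<close>. As the graph may be disconnected, \<open>x\<close> can
  vanish at some vertices.\<close>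

lemma ex_nonneg_eigenvector:
  assumes "finite S" "S \<noteq> {}"
  obtains x where "\<And>u. 0 \<le> x u" "(\<Sum>u\<in>S. (x u)\<^sup>2) = 1"
    "\<And>u. u \<in> S \<Longrightarrow> (\<Sum>v\<in>nbrs S u. x v) = lam S * x u"
proof -
  obtain y where y: "(\<Sum>u\<in>S. (y u)\<^sup>2) = 1"
    "\<And>z. (\<Sum>u\<in>S. (z u)\<^sup>2) = 1 \<Longrightarrow> quad S z \<le> quad S y"
    using quad_attains_max[OF assms] by blast
  define x where "x = (\<lambda>u. \<bar>y u\<bar>)"
  have x1: "(\<Sum>u\<in>S. (x u)\<^sup>2) = 1" using y by (simp add: x_def)
  have "quad S y \<le> quad S x" unfolding x_def by (rule quad_abs)
  then have lam: "lam S = quad S x"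
    using quad_max_eq_lam[OF y] y(2)[OF x1] by simp
  have "(\<Sum>v\<in>nbrs S w. x v) = lam S * x w" if w: "w \<in> S" for w
  proof -
    define D where "D = (\<Sum>v\<in>nbrs S w. x v) - lam S * x w"
    \<comment> \<open>Changing one coordinate by \<open>t\<close> gives no quadratic term in
      \<open>quad\<close>, as there are no loops; the square of \<open>t\<close> enters through the
      norm only.\<close>
    have ineq: "2 * t * D \<le> lam S * t\<^sup>2" for t
    proof -
      let ?e = "\<lambda>u. if u = w then t else 0"
      have e1: "(\<Sum>u\<in>S. ?e u * f u) = t * f w" for f :: "'a \<Rightarrow> real"
      proof -
        have "(\<Sum>u\<in>S. ?e u * f u) = (\<Sum>u\<in>S. if u = w then t * f w else 0)"
          by (intro sum.cong) auto
        then show ?thesis using assms w by simp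
      qed
      have "(\<Sum>u\<in>S. (x u + ?e u)\<^sup>2) = (\<Sum>u\<in>S. (x u)\<^sup>2) + 2 * (\<Sum>u\<in>S. ?e u * x u) + (\<Sum>u\<in>S. ?e u * ?e u)"
        by (simp add: power2_eq_square algebra_simps sum.distrib sum_distrib_left)
      also have "\<dots> = 1 + 2 * t * x w + t\<^sup>2"
        using e1[of x] e1[of ?e] x1 by (simp add: power2_eq_square)
      finally have n: "(\<Sum>u\<in>S. (x u + ?e u)\<^sup>2) = 1 + 2 * t * x w + t\<^sup>2" .
      have "quad S (\<lambda>u. x u + ?e u) = lam S + 2 * (t * (\<Sum>v\<in>nbrs S w. x v))"
        using e1[of "\<lambda>u. \<Sum>v\<in>nbrs S u. x v"] quad_single[OF assms(1) w, of t]
        by (simp add: quad_add[OF assms(1)] lam)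
      then show ?thesis
        using quad_le_lam[OF assms, of "\<lambda>u. x u + ?e u"] n
        by (simp add: D_def algebra_simps)
    qed
    have "D = 0"
    proof (rule ccontr)
      assume "D \<noteq> 0"
      \<comment> \<open>For \<open>t = D / L\<close> with \<open>L\<close> positive and above
        \<open>lam S\<close>, the linear term 2 D^2/L beats the quadratic one, which is at most
        D^2/L.\<close>
      define L where "L = \<bar>lam S\<bar> + 1"
      have L: "L > 0" "lam S < L" by (auto simp: L_def)
      have "2 * (D / L) * D \<le> lam S * (D / L)\<^sup>2" by (rule ineq)
      also have "\<dots> \<le> L * (D / L)\<^sup>2" using L by (intro mult_right_mono) auto
      also have "\<dots> = D * D / L" using L by (simp add: power2_eq_square)
      finally have "2 * (D * D / L) \<le> D * D / L" by simp
      moreover have "D * D / L > 0"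
        using L \<open>D \<noteq> 0\<close> by (metis divide_pos_pos not_real_square_gt_zero)
      ultimately show False by linarith
    qed
    then show ?thesis by (simp add: D_def)
  qed
  then show thesis using that[of x] x1 by (simp add: x_def)
qed

end

section \<open>Weighted clique counts\<close>

lemma weighted_Cauchy_Schwarz:
  fixes a b :: "'i \<Rightarrow> real"
  assumes "\<And>i. i \<in> I \<Longrightarrow> 0 \<le> a i"
  shows "(\<Sum>i\<in>I. a i * b i)\<^sup>2 \<le> (\<Sum>i\<in>I. a i) * (\<Sum>i\<in>I. a i * (b i)\<^sup>2)"
proof -
  have "(\<Sum>i\<in>I. a i * b i) = (\<Sum>i\<in>I. sqrt (a i) * (sqrt (a i) * b i))"
    using assms by (intro sum.cong) (auto simp: mult.assoc[symmetric])
  moreover have "(\<Sum>i\<in>I. a i) = (\<Sum>i\<in>I. (sqrt (a i))\<^sup>2)"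
    using assms by (intro sum.cong) auto
  moreover have "(\<Sum>i\<in>I. a i * (b i)\<^sup>2) = (\<Sum>i\<in>I. (sqrt (a i) * b i)\<^sup>2)"
    using assms by (intro sum.cong) (auto simp: power_mult_distrib)
  ultimately show ?thesis
    using Cauchy_Schwarz_ineq_sum[of "\<lambda>i. sqrt (a i)" "\<lambda>i. sqrt (a i) * b i" I] by simp
qed

context adjacency
begin

definition cliques :: "'a set \<Rightarrow> nat \<Rightarrow> 'a set set" where
  "cliques S s = {R. R \<subseteq> S \<and> card R = s \<and> (\<forall>u\<in>R. \<forall>v\<in>R. u \<noteq> v \<longrightarrow> E u v)}"

definition common :: "'a set \<Rightarrow> 'a set \<Rightarrow> 'a set" where
  "common S R = {v \<in> S. \<forall>u\<in>R. E u v}"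

text \<open>For a probability distribution \<open>p\<close> this is 1/s! times the probability that
  s independent samples form a clique.\<close>

definition wcount :: "('a \<Rightarrow> real) \<Rightarrow> 'a set \<Rightarrow> nat \<Rightarrow> real" where
  "wcount p S s = (\<Sum>R\<in>cliques S s. \<Prod>v\<in>R. p v)"

lemma finite_cliques: "finite S \<Longrightarrow> finite (cliques S s)"
  unfolding cliques_def by (rule finite_subset[of _ "Pow S"]) auto

lemma finite_mem_cliques: "finite S \<Longrightarrow> R \<in> cliques S s \<Longrightarrow> finite R"
  unfolding cliques_def using finite_subset by blast

lemma finite_common: "finite S \<Longrightarrow> finite (common S R)"
  by (simp add: common_def)

lemma sum_common:
  assumes "finite S"
  shows "(\<Sum>v\<in>common S R. f v) = (\<Sum>v\<in>S. if v \<in> common S R then f v else (0::real))"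
proof -
  have "common S R = {v \<in> S. v \<in> common S R}" by (auto simp: common_def)
  then show ?thesis using sum.inter_filter[OF assms, of f "\<lambda>v. v \<in> common S R"] by simp
qed

lemma common_disjoint: "v \<in> common S R \<Longrightarrow> v \<notin> R"
  using irrefl by (auto simp: common_def)

lemma insert_cliques:
  assumes "finite S" "R \<in> cliques S s" "v \<in> common S R"
  shows "insert v R \<in> cliques S (Suc s)"
  using assms common_disjoint[OF assms(3)] finite_mem_cliques[OF assms(1,2)] sym
  by (auto simp: cliques_def common_def)

lemma remove_cliques:
  assumes "finite S" "R \<in> cliques S (Suc s)" "v \<in> R"
  shows "R - {v} \<in> cliques S s" "v \<in> common S (R - {v})"
  using assms finite_mem_cliques[OF assms(1,2)]
  by (auto simp: cliques_def common_def)

text \<open>Double counting through the bijection that sends (R, v) to (\<open>insert v R\<close>,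
  v). All clique counts with weights rest on it.\<close>

lemma sum_cliques_extend:
  assumes "finite S"
  shows "(\<Sum>R\<in>cliques S s. \<Sum>v\<in>common S R. g R v) =
    (\<Sum>Q\<in>cliques S (Suc s). \<Sum>v\<in>Q. g (Q - {v}) v :: real)"
proof -
  have "(\<Sum>R\<in>cliques S s. \<Sum>v\<in>common S R. g R v) =
      (\<Sum>(R, v)\<in>Sigma (cliques S s) (common S). g R v)"
    using assms by (intro sum.Sigma) (auto simp: finite_cliques finite_common)
  also have "\<dots> = (\<Sum>(Q, v)\<in>Sigma (cliques S (Suc s)) (\<lambda>Q. Q). g (Q - {v}) v)"
    by (rule sum.reindex_bij_witness[where i = "\<lambda>(Q, v). (Q - {v}, v)"
          and j = "\<lambda>(R, v). (insert v R, v)"])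
      (use assms in \<open>auto simp: insert_cliques remove_cliques dest: common_disjoint\<close>)
  also have "\<dots> = (\<Sum>Q\<in>cliques S (Suc s). \<Sum>v\<in>Q. g (Q - {v}) v)"
    using assms by (intro sum.Sigma[symmetric]) (auto simp: finite_cliques finite_mem_cliques)
  finally show ?thesis .
qed

lemma wcount_nonneg: "(\<And>v. 0 \<le> p v) \<Longrightarrow> 0 \<le> wcount p S s"
  unfolding wcount_def by (intro sum_nonneg prod_nonneg) auto

lemma wcount_1:
  "wcount p S 1 = (\<Sum>v\<in>S. p v)"
proof -
  have "cliques S 1 = (\<lambda>v. {v}) ` S"
    by (auto simp: cliques_def card_1_singleton_iff)
  then show ?thesis by (simp add: wcount_def sum.reindex)
qed

lemma wcount_Suc:
  assumes "finite S"
  shows "(\<Sum>R\<in>cliques S s. (\<Prod>u\<in>R. p u) * (\<Sum>v\<in>common S R. p v)) = real (Suc s) * wcount p S (Suc s)"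
proof -
  have "(\<Sum>R\<in>cliques S s. (\<Prod>u\<in>R. p u) * (\<Sum>v\<in>common S R. p v)) =
      (\<Sum>Q\<in>cliques S (Suc s). \<Sum>v\<in>Q. (\<Prod>u\<in>Q - {v}. p u) * p v)"
    using sum_cliques_extend[OF assms, of "\<lambda>R v. (\<Prod>u\<in>R. p u) * p v" s]
    by (simp add: sum_distrib_left)
  also have "\<dots> = (\<Sum>Q\<in>cliques S (Suc s). real (Suc s) * (\<Prod>u\<in>Q. p u))"
  proof (rule sum.cong)
    fix Q assume Q: "Q \<in> cliques S (Suc s)"
    have "(\<Sum>v\<in>Q. (\<Prod>u\<in>Q - {v}. p u) * p v) = (\<Sum>v\<in>Q. \<Prod>u\<in>Q. p u)"
      using finite_mem_cliques[OF assms Q]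
      by (intro sum.cong) (auto simp: prod.remove mult.commute)
    then show "(\<Sum>v\<in>Q. (\<Prod>u\<in>Q - {v}. p u) * p v) = real (Suc s) * (\<Prod>u\<in>Q. p u)"
      using Q by (simp add: cliques_def)
  qed auto
  finally show ?thesis by (simp add: wcount_def sum_distrib_left)
qed

text \<open>A vertex adjacent to all of \<open>R\<close> is counted for each of the s + 1 choices of
  \<open>u\<close>. Any other vertex is counted at most once: if it survived the removal of two
  different vertices, it would be adjacent to all of \<open>R\<close>.\<close>

lemma sum_common_remove_le:
  assumes "finite S" "\<And>v. 0 \<le> p v" "R \<in> cliques S (Suc s)"
  shows "(\<Sum>u\<in>R. \<Sum>v\<in>common S (R - {u}). p v) \<le> (\<Sum>v\<in>S. p v) + real s * (\<Sum>v\<in>common S R. p v)"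
proof -
  have finR: "finite R" and cR: "card R = Suc s"
    using finite_mem_cliques[OF assms(1,3)] assms(3) by (auto simp: cliques_def)
  have "(\<Sum>u\<in>R. \<Sum>v\<in>common S (R - {u}). p v) = (\<Sum>u\<in>R. \<Sum>v\<in>S. if v \<in> common S (R - {u}) then p v else 0)"
    by (simp only: sum_common[OF assms(1)])
  also have "\<dots> = (\<Sum>v\<in>S. \<Sum>u\<in>R. if v \<in> common S (R - {u}) then p v else 0)"
    by (rule sum.swap)
  also have "\<dots> = (\<Sum>v\<in>S. real (card {u \<in> R. v \<in> common S (R - {u})}) * p v)"
    using finR by (intro sum.cong) (simp_all add: sum.inter_filter[symmetric])
  also have "\<dots> \<le> (\<Sum>v\<in>S. p v + (if v \<in> common S R then real s * p v else 0))"
  proof (rule sum_mono)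
    fix v assume "v \<in> S"
    show "real (card {u \<in> R. v \<in> common S (R - {u})}) * p v
      \<le> p v + (if v \<in> common S R then real s * p v else 0)"
    proof (cases "v \<in> common S R")
      case True
      have "card {u \<in> R. v \<in> common S (R - {u})} \<le> card R"
        using finR by (intro card_mono) auto
      then have "real (card {u \<in> R. v \<in> common S (R - {u})}) * p v \<le> (real s + 1) * p v"
        using assms(2) cR by (intro mult_right_mono) auto
      then show ?thesis using True by (simp add: algebra_simps)
    next
      case False
      have "card {u \<in> R. v \<in> common S (R - {u})} \<le> Suc 0"
      proof (rule ccontr)
        assume "\<not> card {u \<in> R. v \<in> common S (R - {u})} \<le> Suc 0"
        then obtain u u' where "u \<in> R" "u' \<in> R" "u \<noteq> u'"
          "v \<in> common S (R - {u})" "v \<in> common S (R - {u'})"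
          using finR by (auto simp: card_le_Suc0_iff_eq)
        then have "v \<in> common S R" by (auto simp: common_def)
        then show False using False by simp
      qed
      then have "real (card {u \<in> R. v \<in> common S (R - {u})}) * p v \<le> 1 * p v"
        using assms(2) by (intro mult_right_mono) auto
      then show ?thesis using False by simp
    qed
  qed
  also have "\<dots> = (\<Sum>v\<in>S. p v) + (\<Sum>v\<in>S. if v \<in> common S R then real s * p v else 0)"
    by (rule sum.distrib)
  also have "(\<Sum>v\<in>S. if v \<in> common S R then real s * p v else 0) = (\<Sum>v\<in>common S R. real s * p v)"
    by (simp only: sum_common[OF assms(1)])
  finally show ?thesis by (simp add: sum_distrib_left)
qed

text \<open>Cauchy-Schwarz for the weighted codegree of the s-cliques. The second moment turns into
  a sum over (s+1)-cliques of the codegrees of their s-subcliques, which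
  \<open>sum_common_remove_le\<close> controls.\<close>

lemma Moon_Moser:
  assumes "finite S" "\<And>v. 0 \<le> p v" "(\<Sum>v\<in>S. p v) = 1"
  shows "(real (Suc s) * wcount p S (Suc s))\<^sup>2
    \<le> wcount p S s * (wcount p S (Suc s) + real s * (real (Suc (Suc s)) * wcount p S (Suc (Suc s))))"
proof -
  let ?P = "\<lambda>R. \<Prod>u\<in>R. p u" and ?c = "\<lambda>R. \<Sum>v\<in>common S R. p v"
  have Pn: "?P R \<ge> 0" for R using assms by (intro prod_nonneg) auto
  have "(real (Suc s) * wcount p S (Suc s))\<^sup>2 = (\<Sum>R\<in>cliques S s. ?P R * ?c R)\<^sup>2"
    by (simp only: wcount_Suc[OF assms(1)])
  also have "\<dots> \<le> wcount p S s * (\<Sum>R\<in>cliques S s. ?P R * (?c R)\<^sup>2)"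
    unfolding wcount_def using Pn by (intro weighted_Cauchy_Schwarz)
  also have "(\<Sum>R\<in>cliques S s. ?P R * (?c R)\<^sup>2) = (\<Sum>R\<in>cliques S s. \<Sum>v\<in>common S R. ?P R * p v * ?c R)"
    by (simp add: sum_distrib_left sum_distrib_right power2_eq_square algebra_simps)
  also have "\<dots> = (\<Sum>Q\<in>cliques S (Suc s). \<Sum>v\<in>Q. ?P (Q - {v}) * p v * ?c (Q - {v}))"
    by (rule sum_cliques_extend[OF assms(1)])
  also have "\<dots> = (\<Sum>Q\<in>cliques S (Suc s). ?P Q * (\<Sum>v\<in>Q. ?c (Q - {v})))"
    unfolding sum_distrib_left
    using finite_mem_cliques[OF assms(1)]
    by (intro sum.cong refl arg_cong2[where f = "(*)"]) (auto simp: prod.remove mult.commute)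
  also have "\<dots> \<le> (\<Sum>Q\<in>cliques S (Suc s). ?P Q * (1 + real s * ?c Q))"
    using sum_common_remove_le[of S p, OF assms(1,2)] assms(3) Pn
    by (intro sum_mono mult_left_mono) auto
  also have "\<dots> = wcount p S (Suc s) + real s * (\<Sum>Q\<in>cliques S (Suc s). ?P Q * ?c Q)"
    by (simp add: wcount_def algebra_simps sum.distrib sum_distrib_left)
  also have "(\<Sum>Q\<in>cliques S (Suc s). ?P Q * ?c Q) = real (Suc (Suc s)) * wcount p S (Suc (Suc s))"
    by (rule wcount_Suc[OF assms(1)])
  finally show ?thesis using wcount_nonneg[of p, OF assms(2)] by (simp add: mult_left_mono)
qed

lemma wcount_2:
  assumes "finite S"
  shows "2 * wcount p S 2 = quad S p"
proof -
  have c1: "cliques S 1 = (\<lambda>v. {v}) ` S"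
    by (auto simp: cliques_def card_1_singleton_iff)
  have "2 * wcount p S 2 = (\<Sum>R\<in>cliques S 1. (\<Prod>u\<in>R. p u) * (\<Sum>v\<in>common S R. p v))"
    using wcount_Suc[OF assms, where s = 1 and p = p] by (simp add: numeral_2_eq_2)
  also have "\<dots> = quad S p"
    unfolding c1 by (simp add: sum.reindex quad_def common_def nbrs_def)
  finally show ?thesis .
qed

text \<open>The Moon-Moser inequalities propagate a lower bound on the ratio of consecutive counts,
  and the surplus h of the edge density grows to s h. The value binom(r, s)/r^s is attained by
  uniform weights on a complete graph of order r; it keeps the counts positive, so that ratios make
  sense.\<close>

lemma wcount_chain:
  assumes "finite S" "\<And>v. 0 \<le> p v" "(\<Sum>v\<in>S. p v) = 1" "0 \<le> h"
    and q: "quad S p \<ge> 1 - 1 / real r + h" and s: "1 \<le> s" "s \<le> r"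
  shows "wcount p S s \<ge> real (r choose s) / real r ^ s \<and>
    real (Suc s) * wcount p S (Suc s) \<ge> (1 - real s / real r + real s * h) * wcount p S s"
  using s
proof (induction s rule: dec_induct)
  case base
  then show ?case using wcount_1[of p S] wcount_2[OF assms(1), of p] q assms(3)
    by (simp add: numeral_2_eq_2)
next
  case (step s)
  let ?W = "wcount p S"
  have r: "real r > 0" "real s < real r" "s < r" "s \<ge> 1" using step by auto
  define k where "k = 1 - real s / real r + real s * h"
  have k0: "1 - real s / real r > 0" using r by simp
  have k: "k \<ge> 1 - real s / real r" "k > 0" using k0 assms(4) unfolding k_def
    by (auto intro: add_pos_nonneg)
  have IH: "?W s \<ge> real (r choose s) / real r ^ s" "real (Suc s) * ?W (Suc s) \<ge> k * ?W s"
    using step by (auto simp: k_def)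
  have "real (r choose s) / real r ^ s > 0" using r by simp
  then have Ws: "?W s > 0" using IH by linarith
  have "real (Suc s) * real (r choose Suc s) = real (r - s) * real (r choose s)"
    by (metis binomial_absorb_comp binomial_absorption mult.commute of_nat_mult)
  then have "real (Suc s) * (real (r choose Suc s) / real r ^ Suc s) =
      (1 - real s / real r) * (real (r choose s) / real r ^ s)"
    using r by (simp add: field_simps of_nat_diff)
  also have "\<dots> \<le> k * ?W s" using k IH k0 by (intro mult_mono) auto
  also have "\<dots> \<le> real (Suc s) * ?W (Suc s)" by (rule IH)
  finally have 1: "real (r choose Suc s) / real r ^ Suc s \<le> ?W (Suc s)"
    by (rule mult_left_le_imp_le) simp
  have "real (r choose Suc s) / real r ^ Suc s > 0" using r by simp
  then have Ws1: "?W (Suc s) > 0" using 1 by linarith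
  let ?U = "?W (Suc s) + real s * (real (Suc (Suc s)) * ?W (Suc (Suc s)))"
  have U: "?U > 0" using Ws1 wcount_nonneg[of p S "Suc (Suc s)", OF assms(2)] by (intro add_pos_nonneg) auto
  \<comment> \<open>Only one factor of the square is weakened by the induction hypothesis, so that
    \<open>?W s\<close> cancels against the right-hand side of Moon-Moser.\<close>
  have "(real (Suc s) * ?W (Suc s)) * (k * ?W s) \<le> (real (Suc s) * ?W (Suc s))\<^sup>2"
    unfolding power2_eq_square using IH(2) Ws1 by (intro mult_left_mono) auto
  also have "\<dots> \<le> ?W s * ?U" by (rule Moon_Moser[OF assms(1-3)])
  finally have "real (Suc s) * ?W (Suc s) * k \<le> ?U" using Ws by (simp add: mult.assoc[symmetric])
  then have "(real (Suc s) * k - 1) * ?W (Suc s) \<le> real s * (real (Suc (Suc s)) * ?W (Suc (Suc s)))"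
    by (simp add: algebra_simps)
  moreover have "real (Suc s) * k - 1 = real s * (1 - real (Suc s) / real r + real (Suc s) * h)"
    using r by (simp add: k_def field_simps)
  ultimately have "real s * ((1 - real (Suc s) / real r + real (Suc s) * h) * ?W (Suc s))
      \<le> real s * (real (Suc (Suc s)) * ?W (Suc (Suc s)))"
    by (simp add: mult.assoc)
  then have "(1 - real (Suc s) / real r + real (Suc s) * h) * ?W (Suc s)
      \<le> real (Suc (Suc s)) * ?W (Suc (Suc s))"
    by (rule mult_left_le_imp_le) (use r in simp)
  then show ?case using 1 by simp
qed

text \<open>At s = r the Turan part 1 - r/r of the ratio vanishes and only the surplus r h
  remains.\<close>

lemma wcount_Suc_ge:
  assumes "finite S" "\<And>v. 0 \<le> p v" "(\<Sum>v\<in>S. p v) = 1" "0 \<le> h" "1 \<le> r"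
    and "quad S p \<ge> 1 - 1 / real r + h"
  shows "real (r + 1) * wcount p S (r + 1) \<ge> real r * h / real r ^ r"
proof -
  have 1: "wcount p S r \<ge> 1 / real r ^ r"
    "real (Suc r) * wcount p S (Suc r) \<ge> (1 - real r / real r + real r * h) * wcount p S r"
    using wcount_chain[OF assms(1-4) assms(6), of r] assms(5) by auto
  have "real r * h * (1 / real r ^ r) \<le> real r * h * wcount p S r"
    using 1 assms by (intro mult_left_mono) auto
  then show ?thesis using 1 assms(5) by simp
qed

text \<open>Each (r+1)-clique is counted at its r (r + 1) ordered pairs (u, v). The factor
  \<open>p u * p v\<close> is kept, the other r - 1 weights are bounded by \<open>b\<close>, and the
  kept factors sum to 1 over all pairs.\<close>

lemma wcount_le_joint:
  assumes "finite S" "\<And>v. 0 \<le> p v" "(\<Sum>v\<in>S. p v) = 1" "1 \<le> r"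
    and b: "\<And>v. v \<in> S \<Longrightarrow> p v \<le> b" "0 \<le> b" "0 \<le> t"
    and t: "\<And>u v. u \<in> S \<Longrightarrow> v \<in> S \<Longrightarrow> E u v \<Longrightarrow>
      real (card {Q \<in> cliques S (r + 1). u \<in> Q \<and> v \<in> Q}) \<le> t"
  shows "real r * real (r + 1) * wcount p S (r + 1) \<le> t * b ^ (r - 1)"
proof -
  let ?C = "cliques S (r + 1)" and ?P = "\<lambda>R. \<Prod>u\<in>R. p u"
  let ?D = "\<lambda>u v. {Q \<in> ?C. u \<in> Q \<and> v \<in> Q}"
  have fC: "finite ?C" by (rule finite_cliques[OF assms(1)])
  have Q: "finite Q \<and> Q \<subseteq> S \<and> card Q = r + 1" if "Q \<in> ?C" for Q
    using that finite_mem_cliques[OF assms(1) that] by (simp add: cliques_def)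
  have "real r * real (r + 1) * wcount p S (r + 1) = (\<Sum>Q\<in>?C. \<Sum>u\<in>Q. \<Sum>v\<in>Q - {u}. ?P Q)"
    unfolding wcount_def sum_distrib_left using Q by (intro sum.cong) auto
  also have "\<dots> = (\<Sum>Q\<in>?C. \<Sum>u\<in>S. \<Sum>v\<in>S. if u \<in> Q \<and> v \<in> Q \<and> u \<noteq> v then ?P Q else 0)"
  proof (rule sum.cong[OF refl])
    fix R assume R: "R \<in> ?C"
    have "(\<Sum>u\<in>R. \<Sum>v\<in>R - {u}. ?P R) = (\<Sum>u\<in>R. \<Sum>v\<in>S. if v \<in> R \<and> u \<noteq> v then ?P R else 0)"
      using Q[OF R] assms(1)
      by (intro sum.cong refl sum.mono_neutral_cong_left) auto
    also have "\<dots> = (\<Sum>u\<in>S. \<Sum>v\<in>S. if u \<in> R \<and> v \<in> R \<and> u \<noteq> v then ?P R else 0)"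
      using Q[OF R] assms(1) by (intro sum.mono_neutral_cong_left) (auto intro!: sum.neutral)
    finally show "(\<Sum>u\<in>R. \<Sum>v\<in>R - {u}. ?P R) =
      (\<Sum>u\<in>S. \<Sum>v\<in>S. if u \<in> R \<and> v \<in> R \<and> u \<noteq> v then ?P R else 0)" .
  qed
  also have "\<dots> = (\<Sum>u\<in>S. \<Sum>v\<in>S. \<Sum>Q\<in>?C. if u \<in> Q \<and> v \<in> Q \<and> u \<noteq> v then ?P Q else 0)"
    by (subst sum.swap) (intro sum.cong refl, rule sum.swap)
  also have "\<dots> \<le> (\<Sum>u\<in>S. \<Sum>v\<in>S. p u * p v * (t * b ^ (r - 1)))"
  proof (intro sum_mono)
    fix u v assume uv: "u \<in> S" "v \<in> S"
    have nn: "0 \<le> p u * p v * (t * b ^ (r - 1))" using assms by simp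
    have eq: "(\<Sum>Q\<in>?C. if u \<in> Q \<and> v \<in> Q \<and> u \<noteq> v then ?P Q else 0) =
        (if u \<noteq> v then \<Sum>Q\<in>?D u v. ?P Q else 0)"
      using fC by (auto simp: sum.inter_filter)
    show "(\<Sum>Q\<in>?C. if u \<in> Q \<and> v \<in> Q \<and> u \<noteq> v then ?P Q else 0) \<le> p u * p v * (t * b ^ (r - 1))"
    proof (cases "u \<noteq> v \<and> ?D u v \<noteq> {}")
      case True
      then have E: "E u v" by (auto simp: cliques_def)
      have "(\<Sum>Q\<in>?D u v. ?P Q) \<le> (\<Sum>Q\<in>?D u v. p u * p v * b ^ (r - 1))"
      proof (rule sum_mono)
        fix R assume R: "R \<in> ?D u v"
        then have R': "finite R" "R \<subseteq> S" "card R = r + 1" "u \<in> R" "v \<in> R" using Q by auto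
        have "?P R = p u * ?P (R - {u})" using R' by (intro prod.remove) auto
        also have "?P (R - {u}) = p v * ?P (R - {u} - {v})"
          using R' True by (intro prod.remove) auto
        finally have "?P R = p u * p v * ?P (R - {u} - {v})" by simp
        also have "?P (R - {u} - {v}) \<le> (\<Prod>w\<in>R - {u} - {v}. b)"
          using R' b assms(2) by (intro prod_mono) auto
        also have "\<dots> = b ^ (r - 1)"
        proof -
          have "card (R - {u} - {v}) = r - 1" using R' True by (subst card_Diff_singleton) auto
          then show ?thesis by simp
        qed
        finally show "?P R \<le> p u * p v * b ^ (r - 1)"
          using assms(2) by (simp add: mult_left_mono)
      qed
      also have "\<dots> = real (card (?D u v)) * (p u * p v * b ^ (r - 1))" by simp
      also have "\<dots> \<le> t * (p u * p v * b ^ (r - 1))"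
        using t[OF uv E] assms by (intro mult_right_mono) auto
      finally show ?thesis using eq True by (simp add: algebra_simps)
    next
      case False
      then have "(if u \<noteq> v then \<Sum>Q\<in>?D u v. ?P Q else 0) = 0"
        by (metis (no_types, lifting) sum.empty)
      then show ?thesis using nn eq by simp
    qed
  qed
  also have "\<dots> = (\<Sum>u\<in>S. p u) * (\<Sum>v\<in>S. p v) * (t * b ^ (r - 1))"
    by (simp add: sum_product flip: sum_distrib_right)
  finally show ?thesis using assms(3) by simp
qed

text \<open>The coordinate sum X of a unit Perron vector satisfies X^2 \<le> |S| by Cauchy-Schwarz,
  hence the density bound after division by X. The eigenvalue equation bounds \<mu> times one
  coordinate by a partial sum of X, hence the pointwise bound.\<close>

lemma Perron_weights:
  assumes "finite S" "S \<noteq> {}" "lam S > 0"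
  obtains p where "\<And>v. 0 \<le> p v" "(\<Sum>v\<in>S. p v) = 1" "quad S p \<ge> lam S / card S"
    "\<And>v. v \<in> S \<Longrightarrow> p v \<le> 1 / lam S"
proof -
  obtain x where x: "\<And>u. 0 \<le> x u" "(\<Sum>u\<in>S. (x u)\<^sup>2) = 1"
    "\<And>u. u \<in> S \<Longrightarrow> (\<Sum>v\<in>nbrs S u. x v) = lam S * x u"
    using ex_nonneg_eigenvector[OF assms(1,2)] by blast
  define X where "X = (\<Sum>u\<in>S. x u)"
  have "X \<noteq> 0"
  proof
    assume "X = 0"
    then have "\<forall>u\<in>S. x u = 0" using x assms by (simp add: X_def sum_nonneg_eq_0_iff)
    then show False using x(2) by simp
  qed
  moreover have "X \<ge> 0" unfolding X_def using x by (intro sum_nonneg) auto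
  ultimately have X: "X > 0" by simp
  define p where "p = (\<lambda>v. 1 / X * x v)"
  have "quad S x = lam S"
  proof -
    have "quad S x = (\<Sum>u\<in>S. lam S * (x u)\<^sup>2)"
      unfolding quad_def using x(3) by (intro sum.cong) (auto simp: power2_eq_square)
    then show ?thesis using x(2) by (simp add: sum_distrib_left[symmetric])
  qed
  then have qp: "quad S p = lam S / X\<^sup>2"
    unfolding p_def quad_scale by (simp add: power_divide)
  have "X\<^sup>2 \<le> card S"
    using weighted_Cauchy_Schwarz[of S "\<lambda>_. 1" x] x(2) by (simp add: X_def)
  then have "lam S / card S \<le> lam S / X\<^sup>2"
    using X assms by (intro divide_left_mono) (auto simp: card_gt_0_iff)
  moreover have "p v \<le> 1 / lam S" if "v \<in> S" for v
  proof -
    have "lam S * x v = (\<Sum>u\<in>nbrs S v. x u)" using x that by simp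
    also have "\<dots> \<le> X" unfolding X_def using x assms nbrs_subset by (intro sum_mono2) auto
    finally show ?thesis using X assms by (simp add: p_def field_simps)
  qed
  moreover have "(\<Sum>v\<in>S. p v) = 1"
    using X by (simp add: p_def sum_divide_distrib[symmetric] X_def)
  ultimately show thesis using that[of p] x X qp by (simp add: p_def)
qed

text \<open>Wilf's theorem in contrapositive form: a positive surplus \<open>h\<close> makes the
  weighted number of (r+1)-cliques positive.\<close>

lemma ex_clique_of_lam:
  assumes "finite S" "S \<noteq> {}" "2 \<le> r" "lam S > (1 - 1 / real r) * card S"
  shows "cliques S (r + 1) \<noteq> {}"
proof
  assume e: "cliques S (r + 1) = {}"
  have S: "real (card S) > 0" using assms by (simp add: card_gt_0_iff)
  have "(1 - 1 / real r) * card S \<ge> 0" using assms by simp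
  then have pos: "lam S > 0" using assms by linarith
  obtain p where p: "\<And>v. 0 \<le> p v" "(\<Sum>v\<in>S. p v) = 1" "quad S p \<ge> lam S / card S"
    "\<And>v. v \<in> S \<Longrightarrow> p v \<le> 1 / lam S"
    using Perron_weights[OF assms(1,2) pos] by blast
  define h where "h = lam S / card S - (1 - 1 / real r)"
  have h: "h > 0" using assms S by (simp add: h_def field_simps)
  have "real (r + 1) * wcount p S (r + 1) \<ge> real r * h / real r ^ r"
    using h assms p by (intro wcount_Suc_ge) (auto simp: h_def)
  moreover have "real r * h / real r ^ r > 0" using h assms by simp
  ultimately show False using e by (simp add: wcount_def)
qed

text \<open>Lower and upper bound on the weighted number of (r+1)-cliques, compared at the Perron
  weights with \<open>b = 1 / lam S\<close>.\<close>

lemma joint_of_lam: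
  assumes "finite S" "S \<noteq> {}" "2 \<le> r" "0 \<le> h" "lam S \<ge> (1 - 1 / real r + h) * card S"
    and t: "0 \<le> t" "\<And>u v. u \<in> S \<Longrightarrow> v \<in> S \<Longrightarrow> E u v \<Longrightarrow>
      real (card {Q \<in> cliques S (r + 1). u \<in> Q \<and> v \<in> Q}) \<le> t"
  shows "real r ^ 2 * h * lam S ^ (r - 1) \<le> t * real r ^ r"
proof -
  have S: "real (card S) > 0" using assms by (simp add: card_gt_0_iff)
  have "1 - 1 / real r + h > 0" using assms by (intro add_pos_nonneg) auto
  then have "(1 - 1 / real r + h) * card S > 0" using S by simp
  then have pos: "lam S > 0" using assms by linarith
  obtain p where p: "\<And>v. 0 \<le> p v" "(\<Sum>v\<in>S. p v) = 1" "quad S p \<ge> lam S / card S"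
    "\<And>v. v \<in> S \<Longrightarrow> p v \<le> 1 / lam S"
    using Perron_weights[OF assms(1,2) pos] by blast
  have "1 - 1 / real r + h \<le> lam S / card S" using assms S by (simp add: field_simps)
  then have "real (r + 1) * wcount p S (r + 1) \<ge> real r * h / real r ^ r"
    using assms p by (intro wcount_Suc_ge) auto
  then have "real r * (real r * h / real r ^ r) \<le> real r * (real (r + 1) * wcount p S (r + 1))"
    by (intro mult_left_mono) auto
  also have "\<dots> \<le> t * (1 / lam S) ^ (r - 1)"
    using wcount_le_joint[OF assms(1) p(1,2), of r "1 / lam S" t] assms pos p
    by (simp add: mult.assoc)
  finally have "real r ^ 2 * h / real r ^ r \<le> t / lam S ^ (r - 1)"
    by (simp add: power2_eq_square power_divide mult.assoc)
  then show ?thesis using pos assms by (simp add: field_simps)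
qed

end

section \<open>Joints in graphs of large minimum degree\<close>

context adjacency
begin

text \<open>Let d_w be the number of vertices of \<open>K\<close> adjacent to w. The codegrees of
  the ordered pairs in \<open>K\<close> add up to the sum of d_w (d_w - 1), the degrees to the sum
  of d_w. A chord bound gives the first sum in terms of the second, and some pair is at least
  average.\<close>

lemma ex_edge_large_codegree:
  assumes "finite S" "2 \<le> r" "K \<in> cliques S (r + 1)"
    and D: "\<And>v. v \<in> S \<Longrightarrow> D \<le> real (card (nbrs S v))"
  obtains u v where "u \<in> K" "v \<in> K" "u \<noteq> v"
    "2 * (real r - 1) * D / real r - (real r - 1) * real (card S) / (real r + 1) \<le> real (card (common S {u, v}))"
proof -
  let ?i = "\<lambda>u w. if E u w then 1 else 0 :: real"
  let ?d = "\<lambda>w. \<Sum>u\<in>K. ?i u w"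
  let ?m = "real (card S)" and ?r = "real r"
  define B where "B = 2 * (?r - 1) * D / ?r - (?r - 1) * ?m / (?r + 1)"
  have K: "finite K" "K \<subseteq> S" "card K = r + 1" "K \<noteq> {}"
    using assms finite_mem_cliques[OF assms(1,3)] by (auto simp: cliques_def)
  have codeg: "real (card (common S {u, v})) = (\<Sum>w\<in>S. ?i u w * ?i v w)" for u v
  proof -
    have "(\<Sum>w\<in>S. ?i u w * ?i v w) = (\<Sum>w\<in>S. if w \<in> common S {u, v} then 1 else 0)"
      by (intro sum.cong) (auto simp: common_def)
    then show ?thesis using sum_common[OF assms(1), of "\<lambda>_. 1" "{u, v}"] by simp
  qed
  have deg: "real (card (nbrs S u)) = (\<Sum>w\<in>S. ?i u w)" for u
    using sum_nbrs[OF assms(1), of "\<lambda>_. 1" u] by simp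
  have "(\<Sum>u\<in>K. \<Sum>v\<in>K. real (card (common S {u, v}))) = (\<Sum>u\<in>K. \<Sum>w\<in>S. \<Sum>v\<in>K. ?i u w * ?i v w)"
    unfolding codeg by (intro sum.cong refl sum.swap)
  also have "\<dots> = (\<Sum>w\<in>S. \<Sum>u\<in>K. \<Sum>v\<in>K. ?i u w * ?i v w)" by (rule sum.swap)
  also have "\<dots> = (\<Sum>w\<in>S. (?d w)\<^sup>2)" by (simp only: power2_eq_square sum_product)
  finally have pairs: "(\<Sum>u\<in>K. \<Sum>v\<in>K. real (card (common S {u, v}))) = (\<Sum>w\<in>S. (?d w)\<^sup>2)" .
  have "(\<Sum>u\<in>K. real (card (nbrs S u))) = (\<Sum>w\<in>S. ?d w)"
    unfolding deg by (rule sum.swap)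
  moreover have "(\<Sum>u\<in>K. real (card (nbrs S u))) \<ge> (\<Sum>u\<in>K. D)"
    using D K by (intro sum_mono) auto
  ultimately have degs: "(\<Sum>w\<in>S. ?d w) = (\<Sum>u\<in>K. real (card (nbrs S u)))" "(\<Sum>w\<in>S. ?d w) \<ge> (?r + 1) * D"
    using K by (auto simp: algebra_simps)
  have split: "(\<Sum>v\<in>K. real (card (common S {u, v}))) =
      real (card (nbrs S u)) + (\<Sum>v\<in>K - {u}. real (card (common S {u, v})))" if "u \<in> K" for u
    using K that by (subst sum.remove[of K u]) (auto simp: common_def nbrs_def)
  have "(\<Sum>u\<in>K. \<Sum>v\<in>K - {u}. real (card (common S {u, v}))) = (\<Sum>w\<in>S. (?d w)\<^sup>2) - (\<Sum>w\<in>S. ?d w)"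
    using pairs degs(1) by (simp add: split sum.distrib)
  also have "\<dots> = (\<Sum>w\<in>S. (?d w)\<^sup>2 - ?d w)" by (simp add: sum_subtractf)
  finally have pairs': "(\<Sum>u\<in>K. \<Sum>v\<in>K - {u}. real (card (common S {u, v}))) = (\<Sum>w\<in>S. (?d w)\<^sup>2 - ?d w)" .
  have "(?r + 1) * (?r * B) = 2 * (?r - 1) * ((?r + 1) * D) - ?m * (?r * (?r - 1))"
  proof -
    have "?r \<noteq> 0" "?r + 1 \<noteq> 0" using assms(2) by auto
    then show ?thesis by (simp add: B_def divide_simps)
  qed
  also have "\<dots> \<le> 2 * (?r - 1) * (\<Sum>w\<in>S. ?d w) - ?m * (?r * (?r - 1))"
    using degs assms(2) by (intro diff_right_mono mult_left_mono) auto
  also have "\<dots> = (\<Sum>w\<in>S. 2 * (?r - 1) * ?d w - ?r * (?r - 1))"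
    by (simp add: sum_subtractf sum_distrib_left del: right_diff_distrib left_diff_distrib)
  also have "\<dots> \<le> (\<Sum>w\<in>S. (?d w)\<^sup>2 - ?d w)"
  proof (rule sum_mono)
    fix w
    have "?d w = real (card {u \<in> K. E u w})"
      using K by (simp add: sum.inter_filter[symmetric])
    then obtain k where k: "?d w = real k" by blast
    \<comment> \<open>The chord of k^2 - k through the integers r - 1 and r. They enclose (r + 1) (1
      - 1/r) = r - 1/r, the mean of d_w when all degrees are (1 - 1/r) |S|.\<close>
    have "0 \<le> (real k - ?r) * (real k - (?r - 1))"
    proof (cases "k \<ge> r")
      case False
      then have "real k \<le> ?r - 1" by linarith
      then show ?thesis by (intro mult_nonpos_nonpos) auto
    qed auto
    then show "2 * (?r - 1) * ?d w - ?r * (?r - 1) \<le> (?d w)\<^sup>2 - ?d w"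
      unfolding k by (simp add: power2_eq_square algebra_simps)
  qed
  finally have total: "(?r + 1) * (?r * B) \<le> (\<Sum>u\<in>K. \<Sum>v\<in>K - {u}. real (card (common S {u, v})))"
    by (simp only: pairs')
  have "\<exists>u\<in>K. \<exists>v\<in>K - {u}. B \<le> real (card (common S {u, v}))"
  proof (rule ccontr)
    assume "\<not> ?thesis"
    then have less: "real (card (common S {u, v})) < B" if "u \<in> K" "v \<in> K - {u}" for u v
      using that by force
    have "(\<Sum>v\<in>K - {u}. real (card (common S {u, v}))) < ?r * B" if "u \<in> K" for u
    proof -
      have c: "card (K - {u}) = r" using K that by simp
      then have "K - {u} \<noteq> {}" using assms(2) by (metis card.empty not_numeral_le_zero)
      then have "(\<Sum>v\<in>K - {u}. real (card (common S {u, v}))) < (\<Sum>v\<in>K - {u}. B)"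
        using K less that by (intro sum_strict_mono) auto
      then show ?thesis using c by simp
    qed
    then have "(\<Sum>u\<in>K. \<Sum>v\<in>K - {u}. real (card (common S {u, v}))) < (\<Sum>u\<in>K. ?r * B)"
      using K by (intro sum_strict_mono) auto
    then show False using total K by (simp add: algebra_simps)
  qed
  then show thesis using that unfolding B_def by blast
qed

text \<open>Union bound: each of the j - 2 vertices of \<open>A\<close> other than \<open>u\<close>
  and \<open>v\<close> excludes at most |S| - D vertices.\<close>

lemma card_common_ge:
  assumes "finite S" "A \<in> cliques S j" "u \<in> A" "v \<in> A" "u \<noteq> v"
    and D: "\<And>v. v \<in> S \<Longrightarrow> D \<le> real (card (nbrs S v))"
  shows "real (card (common S {u, v})) - (real j - 2) * (real (card S) - D) \<le> real (card (common S A))"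
proof -
  have A: "finite A" "A \<subseteq> S" "card A = j"
    using assms finite_mem_cliques[OF assms(1,2)] by (auto simp: cliques_def)
  have "common S {u, v} \<subseteq> common S A \<union> (\<Union>w\<in>A - {u, v}. S - nbrs S w)"
    by (auto simp: common_def nbrs_def)
  then have "card (common S {u, v}) \<le> card (common S A \<union> (\<Union>w\<in>A - {u, v}. S - nbrs S w))"
    using assms A by (intro card_mono) (auto simp: finite_common)
  also have "\<dots> \<le> card (common S A) + card (\<Union>w\<in>A - {u, v}. S - nbrs S w)"
    by (rule card_Un_le)
  also have "\<dots> \<le> card (common S A) + (\<Sum>w\<in>A - {u, v}. card (S - nbrs S w))"
    using A by (intro add_left_mono card_UN_le) auto
  finally have "real (card (common S {u, v})) \<le> real (card (common S A)) + (\<Sum>w\<in>A - {u, v}. real (card (S - nbrs S w)))"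
    by (metis of_nat_add of_nat_le_iff of_nat_sum)
  moreover have "(\<Sum>w\<in>A - {u, v}. real (card (S - nbrs S w))) \<le> (\<Sum>w\<in>A - {u, v}. real (card S) - D)"
  proof (rule sum_mono)
    fix w assume "w \<in> A - {u, v}"
    then have "w \<in> S" using A by auto
    then show "real (card (S - nbrs S w)) \<le> real (card S) - D"
      using D[of w] assms(1) nbrs_subset[of S w] card_mono[OF assms(1) nbrs_subset, of w]
      by (simp add: card_Diff_subset finite_nbrs of_nat_diff)
  qed
  moreover have "real (card (A - {u, v})) = real j - 2"
  proof -
    have "card {u, v} \<le> card A" using A assms by (intro card_mono) auto
    then show ?thesis using A assms by (simp add: card_Diff_subset of_nat_diff)
  qed
  ultimately show ?thesis by simp
qed

text \<open>Each k-clique above \<open>A\<close> is counted once for each of its k - j vertices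
  outside \<open>A\<close>, all of which are common neighbours of \<open>A\<close>.\<close>

lemma extensions_double_count:
  assumes "finite S" "A \<in> cliques S j"
  shows "(\<Sum>v\<in>common S A. real (card {Q \<in> cliques S k. insert v A \<subseteq> Q})) =
    (real k - real j) * real (card {Q \<in> cliques S k. A \<subseteq> Q})"
proof -
  let ?X = "{Q \<in> cliques S k. A \<subseteq> Q}"
  have A: "finite A" "A \<subseteq> S" "card A = j"
    using assms finite_mem_cliques[OF assms] by (auto simp: cliques_def)
  have fX: "finite ?X" using finite_cliques[OF assms(1)] by simp
  have "(\<Sum>v\<in>common S A. real (card {Q \<in> cliques S k. insert v A \<subseteq> Q})) =
      (\<Sum>v\<in>common S A. \<Sum>Q\<in>?X. if v \<in> Q then 1 else 0)"
  proof (rule sum.cong)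
    fix v
    have "{Q \<in> cliques S k. insert v A \<subseteq> Q} = {Q \<in> ?X. v \<in> Q}" by auto
    then show "real (card {Q \<in> cliques S k. insert v A \<subseteq> Q}) = (\<Sum>Q\<in>?X. if v \<in> Q then 1 else 0)"
      using fX by (simp add: sum.inter_filter[symmetric])
  qed simp
  also have "\<dots> = (\<Sum>Q\<in>?X. \<Sum>v\<in>common S A. if v \<in> Q then 1 else 0)" by (rule sum.swap)
  also have "\<dots> = (\<Sum>Q\<in>?X. real k - real j)"
  proof (rule sum.cong)
    fix Q assume Q: "Q \<in> ?X"
    then have Q': "finite Q" "card Q = k" "A \<subseteq> Q" "Q \<subseteq> S"
      using finite_mem_cliques[OF assms(1), of Q k] by (auto simp: cliques_def)
    have "{v \<in> common S A. v \<in> Q} = Q - A"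
    proof (intro equalityI subsetI)
      fix x assume "x \<in> {v \<in> common S A. v \<in> Q}"
      then show "x \<in> Q - A" using common_disjoint[of x S A] by simp
    next
      fix x assume x: "x \<in> Q - A"
      have "E a x" if "a \<in> A" for a
      proof -
        have "a \<in> Q" "a \<noteq> x" using that Q'(3) x by auto
        then show ?thesis using Q x by (simp add: cliques_def)
      qed
      then show "x \<in> {v \<in> common S A. v \<in> Q}" using x Q'(4) by (auto simp: common_def)
    qed
    then have "(\<Sum>v\<in>common S A. if v \<in> Q then 1 else 0 :: real) = real (card (Q - A))"
      using assms(1) by (simp add: sum.inter_filter[symmetric] finite_common)
    also have "\<dots> = real k - real j"
      using A Q' card_mono[of Q A] by (simp add: card_Diff_subset of_nat_diff)
    finally show "(\<Sum>v\<in>common S A. if v \<in> Q then 1 else 0) = real k - real j" .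
  qed simp
  finally show ?thesis by simp
qed

text \<open>Count ordered extensions of \<open>A\<close>. While i vertices are missing to size r
  there are at least i m/r choices, and for the last vertex at least \<open>a\<close>, so there are
  a k! (m/r)^k orders; each (r+1)-clique arises from (k + 1)! of them, which leaves the factor 1/(k
  + 1). The induction does this one vertex at a time.\<close>

lemma card_extensions_ge:
  assumes "finite S" "u \<noteq> v" "0 \<le> a" "0 < r"
    and C: "\<And>A j. A \<in> cliques S j \<Longrightarrow> u \<in> A \<Longrightarrow> v \<in> A \<Longrightarrow> j \<le> r \<Longrightarrow>
      (1 - real j / real r) * real (card S) + a \<le> real (card (common S A))"
  shows "A \<in> cliques S (r - k) \<Longrightarrow> u \<in> A \<Longrightarrow> v \<in> A \<Longrightarrow> k < r \<Longrightarrow>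
    a * (real (card S) / real r) ^ k / (real k + 1) \<le> real (card {Q \<in> cliques S (r + 1). A \<subseteq> Q})"
proof (induction k arbitrary: A)
  case 0
  have "real (card (common S A)) \<le> (\<Sum>w\<in>common S A. real (card {Q \<in> cliques S (r + 1). insert w A \<subseteq> Q}))"
  proof -
    have "1 \<le> real (card {Q \<in> cliques S (r + 1). insert w A \<subseteq> Q})" if "w \<in> common S A" for w
    proof -
      have "insert w A \<in> {Q \<in> cliques S (r + 1). insert w A \<subseteq> Q}"
        using insert_cliques[OF assms(1) 0(1) that] by auto
      then have "card {Q \<in> cliques S (r + 1). insert w A \<subseteq> Q} > 0"
        using finite_cliques[OF assms(1)] by (subst card_gt_0_iff) auto
      then show ?thesis by simp
    qed
    then have "(\<Sum>w\<in>common S A. 1) \<le> (\<Sum>w\<in>common S A. real (card {Q \<in> cliques S (r + 1). insert w A \<subseteq> Q}))"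
      by (intro sum_mono) auto
    then show ?thesis by simp
  qed
  also have "\<dots> = real (card {Q \<in> cliques S (r + 1). A \<subseteq> Q})"
    using extensions_double_count[OF assms(1) 0(1), of "r + 1"] by simp
  finally show ?case using C[OF 0(1-3)] assms by simp
next
  case (Suc k)
  let ?m = "real (card S)"
  let ?L = "a * (?m / real r) ^ k / (real k + 1)"
  have L: "0 \<le> ?L" using assms by simp
  have eq: "Suc (r - Suc k) = r - k" using Suc by simp
  have "((real k + 1) * (?m / real r)) * ?L \<le> real (card (common S A)) * ?L"
  proof (rule mult_right_mono[OF _ L])
    have "(1 - real (r - Suc k) / real r) * ?m + a \<le> real (card (common S A))"
      using C[OF Suc.prems(1-3)] by simp
    moreover have "(1 - real (r - Suc k) / real r) * ?m = (real k + 1) * (?m / real r)"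
      using Suc.prems by (simp add: of_nat_diff field_simps)
    ultimately show "(real k + 1) * (?m / real r) \<le> real (card (common S A))"
      using assms by simp
  qed
  also have "\<dots> = (\<Sum>w\<in>common S A. ?L)" by simp
  also have "\<dots> \<le> (\<Sum>w\<in>common S A. real (card {Q \<in> cliques S (r + 1). insert w A \<subseteq> Q}))"
    using insert_cliques[OF assms(1) Suc.prems(1)] Suc.prems
    by (intro sum_mono Suc.IH) (auto simp: eq)
  also have "\<dots> = (real (r + 1) - real (r - Suc k)) * real (card {Q \<in> cliques S (r + 1). A \<subseteq> Q})"
    by (rule extensions_double_count[OF assms(1) Suc.prems(1)])
  also have "real (r + 1) - real (r - Suc k) = real k + 2" using Suc.prems by (simp add: of_nat_diff)
  finally have "((real k + 1) * (?m / real r)) * ?L \<le> (real k + 2) * real (card {Q \<in> cliques S (r + 1). A \<subseteq> Q})" .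
  moreover have "((real k + 1) * (?m / real r)) * ?L = a * (?m / real r) ^ Suc k"
  proof -
    have "real k + 1 \<noteq> 0" by linarith
    then show ?thesis by simp
  qed
  ultimately have le: "a * (?m / real r) ^ Suc k
      \<le> real (card {Q \<in> cliques S (r + 1). A \<subseteq> Q}) * (real (Suc k) + 1)"
    by (simp add: algebra_simps)
  show ?case by (rule mult_imp_div_pos_le[OF _ le]) simp
qed

text \<open>The best edge of one (r+1)-clique has enough codegree that every clique of size j \<le>
  r through it keeps (1 - j/r) m + m/r^4 common neighbours. The last summand is what remains at j =
  r.\<close>

lemma joint_of_min_degree:
  assumes "finite S" "2 \<le> r" "cliques S (r + 1) \<noteq> {}"
    and D: "\<And>v. v \<in> S \<Longrightarrow> (1 - 1 / real r - 1 / real r ^ 4) * real (card S) \<le> real (card (nbrs S v))"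
  obtains u v where "u \<in> S" "v \<in> S" "E u v"
    "real (card S) / real r ^ 4 * (real (card S) / real r) ^ (r - 2) / (real r - 1)
      \<le> real (card {Q \<in> cliques S (r + 1). u \<in> Q \<and> v \<in> Q})"
proof -
  let ?m = "real (card S)" and ?r = "real r"
  define D where "D = (1 - 1 / ?r - 1 / ?r ^ 4) * ?m"
  obtain K where K: "K \<in> cliques S (r + 1)" using assms by blast
  have Dle: "\<And>v. v \<in> S \<Longrightarrow> D \<le> real (card (nbrs S v))" using D by (simp add: D_def)
  obtain u v where uv: "u \<in> K" "v \<in> K" "u \<noteq> v"
    "2 * (?r - 1) * D / ?r - (?r - 1) * ?m / (?r + 1) \<le> real (card (common S {u, v}))"
    using ex_edge_large_codegree[OF assms(1,2) K Dle] by blast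
  have E: "E u v" "u \<in> S" "v \<in> S" using K uv by (auto simp: cliques_def)
  have r2: "?r \<ge> 2" using assms(2) by simp
  have C: "(1 - real j / ?r) * ?m + ?m / ?r ^ 4 \<le> real (card (common S A))"
    if A: "A \<in> cliques S j" "u \<in> A" "v \<in> A" and j: "j \<le> r" for A j
  proof -
    \<comment> \<open>Relative to m, the edge has surplus 2/(r^2 (r + 1)); the degree deficit costs
      (x - 2/r)/r^4 and the reserve 1/r^4. The worst case is x = r, where the numerator below equals
      r (r - 1)^2 + 2.\<close>
    have num: "(1 - x / ?r) + 1 / ?r ^ 4 \<le>
      2 * (?r - 1) * (1 - 1 / ?r - 1 / ?r ^ 4) / ?r - (?r - 1) / (?r + 1) - (x - 2) * (1 / ?r + 1 / ?r ^ 4)"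
      if "x \<le> ?r" for x :: real
    proof -
      have "2 * (?r - 1) * (1 - 1 / ?r - 1 / ?r ^ 4) / ?r - (?r - 1) / (?r + 1) - (x - 2) * (1 / ?r + 1 / ?r ^ 4)
          - ((1 - x / ?r) + 1 / ?r ^ 4) =
          (2 * ?r ^ 3 - (?r + 1) * (?r * x - 2) - ?r * (?r + 1)) / (?r ^ 5 * (?r + 1))"
        using r2 by (simp add: divide_simps) (simp add: algebra_simps eval_nat_numeral)
      moreover have "2 * ?r ^ 3 - (?r + 1) * (?r * x - 2) - ?r * (?r + 1) \<ge> 0"
      proof -
        have "(?r + 1) * (?r * x - 2) \<le> (?r + 1) * (?r * ?r - 2)"
          using that r2 by (intro mult_left_mono diff_right_mono) auto
        moreover have "0 \<le> ?r * (?r - 1)\<^sup>2" using r2 by simp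
        ultimately show ?thesis by (simp add: algebra_simps power2_eq_square power3_eq_cube)
      qed
      ultimately have "0 \<le> 2 * (?r - 1) * (1 - 1 / ?r - 1 / ?r ^ 4) / ?r - (?r - 1) / (?r + 1)
          - (x - 2) * (1 / ?r + 1 / ?r ^ 4) - ((1 - x / ?r) + 1 / ?r ^ 4)"
        by (simp only: divide_nonneg_nonneg) simp
      then show ?thesis by linarith
    qed
    have "((1 - real j / ?r) + 1 / ?r ^ 4) * ?m \<le>
      (2 * (?r - 1) * (1 - 1 / ?r - 1 / ?r ^ 4) / ?r - (?r - 1) / (?r + 1) - (real j - 2) * (1 / ?r + 1 / ?r ^ 4)) * ?m"
      using num[of "real j"] j by (intro mult_right_mono) auto
    also have "\<dots> = 2 * (?r - 1) * D / ?r - (?r - 1) * ?m / (?r + 1) - (real j - 2) * (?m - D)"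
      by (simp add: D_def algebra_simps diff_divide_distrib)
    also have "\<dots> \<le> real (card (common S {u, v})) - (real j - 2) * (?m - D)"
      using uv by simp
    also have "\<dots> \<le> real (card (common S A))"
      by (rule card_common_ge[OF assms(1) A uv(3) Dle])
    finally show ?thesis by (simp add: algebra_simps)
  qed
  have uvc: "{u, v} \<in> cliques S (r - (r - 2))"
    using E uv sym assms(2) by (auto simp: cliques_def)
  have "?m / ?r ^ 4 * (?m / ?r) ^ (r - 2) / (real (r - 2) + 1)
      \<le> real (card {Q \<in> cliques S (r + 1). {u, v} \<subseteq> Q})"
    by (rule card_extensions_ge[OF assms(1) uv(3) _ _ C uvc]) (use assms in auto)
  then show thesis using that[OF E(2,3,1)] assms(2) by (simp add: of_nat_diff)
qed

text \<open>On \<open>S - {w}\<close> the unit Perron vector x has squared norm 1 - x_w^2 and form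
  \<mu> - 2 \<mu> x_w^2. Since deletion costs at least c, this gives x_w^2 \<ge> c/(\<mu> + c) for
  every w. So the |S| - d non-neighbours of \<open>v\<close> hold at least (|S| - d) c/(\<mu> + c)
  of the unit mass, and Cauchy-Schwarz bounds \<mu> x_v, the sum over the neighbours, by the mass
  left to them.\<close>

lemma degree_of_local_max:
  assumes "finite S" "2 \<le> card S" "0 < c" "0 < lam S"
    and loc: "\<And>v. v \<in> S \<Longrightarrow> lam (S - {v}) \<le> lam S - c" and v: "v \<in> S"
  defines "d \<equiv> real (card (nbrs S v))"
  shows "c * (lam S)\<^sup>2 \<le> d * (lam S + c - (real (card S) - d) * c)"
proof -
  let ?\<mu> = "lam S"
  have ne: "S \<noteq> {}" using v by auto
  obtain x where x: "\<And>u. 0 \<le> x u" "(\<Sum>u\<in>S. (x u)\<^sup>2) = 1"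
    "\<And>u. u \<in> S \<Longrightarrow> (\<Sum>v\<in>nbrs S u. x v) = ?\<mu> * x u"
    using ex_nonneg_eigenvector[OF assms(1) ne] by blast
  have quadx: "quad S x = ?\<mu>"
  proof -
    have "quad S x = (\<Sum>u\<in>S. ?\<mu> * (x u)\<^sup>2)"
      unfolding quad_def using x(3) by (intro sum.cong) (auto simp: power2_eq_square)
    then show ?thesis using x(2) by (simp add: sum_distrib_left[symmetric])
  qed
  have low: "c \<le> (?\<mu> + c) * (x w)\<^sup>2" if w: "w \<in> S" for w
  proof -
    let ?T = "S - {w}"
    have T: "finite ?T" "?T \<noteq> {}"
      using assms(1,2) w by (auto simp: subset_singleton_iff dest: card_mono[rotated])
    have "(\<Sum>u\<in>S. (x u)\<^sup>2) = (x w)\<^sup>2 + (\<Sum>u\<in>?T. (x u)\<^sup>2)"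
      using assms(1) w by (rule sum.remove)
    then have n: "(\<Sum>u\<in>?T. (x u)\<^sup>2) = 1 - (x w)\<^sup>2" using x by simp
    have nb: "(\<Sum>v\<in>nbrs ?T u. x v) = ?\<mu> * x u - (if E u w then x w else 0)" if "u \<in> ?T" for u
    proof -
      have "(\<Sum>v\<in>nbrs S u. x v) = (if E u w then x w else 0) + (\<Sum>v\<in>nbrs ?T u. x v)"
        using assms(1) w by (simp add: sum_nbrs sum.remove[of S w])
      then show ?thesis using x(3)[of u] that by simp
    qed
    have "quad ?T x = (\<Sum>u\<in>?T. ?\<mu> * (x u)\<^sup>2) - (\<Sum>u\<in>?T. if E u w then x u * x w else 0)"
      unfolding quad_def sum_subtractf[symmetric]
      by (intro sum.cong refl) (auto simp: nb power2_eq_square algebra_simps)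
    also have "(\<Sum>u\<in>?T. if E u w then x u * x w else 0) = x w * (\<Sum>u\<in>nbrs S w. x u)"
    proof -
      have "(\<Sum>u\<in>nbrs S w. x u) = (\<Sum>u\<in>S. if E u w then x u else 0)"
        unfolding sum_nbrs[OF assms(1)] using sym by (intro sum.cong) auto
      also have "\<dots> = (\<Sum>u\<in>?T. if E u w then x u else 0)"
        using irrefl[of w] by (subst sum.remove[OF assms(1) w]) simp
      finally show ?thesis
        by (simp only: sum_distrib_left) (intro sum.cong refl, simp)
    qed
    also have "\<dots> = ?\<mu> * (x w)\<^sup>2" using x(3)[OF w] by (simp add: power2_eq_square)
    also have "(\<Sum>u\<in>?T. ?\<mu> * (x u)\<^sup>2) = ?\<mu> * (1 - (x w)\<^sup>2)"
      by (simp add: sum_distrib_left[symmetric] n)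
    finally have q: "quad ?T x = ?\<mu> * (1 - (x w)\<^sup>2) - ?\<mu> * (x w)\<^sup>2" .
    have nn: "0 \<le> 1 - (x w)\<^sup>2" unfolding n[symmetric] by (intro sum_nonneg) auto
    have "quad ?T x \<le> lam ?T * (1 - (x w)\<^sup>2)" using quad_le_lam[OF T, of x] n by simp
    also have "\<dots> \<le> (?\<mu> - c) * (1 - (x w)\<^sup>2)" using loc[OF w] nn by (intro mult_right_mono)
    finally show ?thesis unfolding q by (simp add: algebra_simps)
  qed
  let ?N = "nbrs S v"
  have fN: "finite ?N" "?N \<subseteq> S" using assms(1) nbrs_subset by (auto simp: finite_nbrs)
  have d: "real (card (S - ?N)) = real (card S) - d"
    using fN card_mono[OF assms(1) fN(2)] by (simp add: d_def card_Diff_subset of_nat_diff)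
  have "(real (card S) - d) * c \<le> (\<Sum>u\<in>S - ?N. (?\<mu> + c) * (x u)\<^sup>2)"
  proof -
    have "(\<Sum>u\<in>S - ?N. c) \<le> (\<Sum>u\<in>S - ?N. (?\<mu> + c) * (x u)\<^sup>2)" using low by (intro sum_mono) auto
    then show ?thesis using d by simp
  qed
  also have "\<dots> = (?\<mu> + c) * (1 - (\<Sum>u\<in>?N. (x u)\<^sup>2))"
    using sum_diff[OF assms(1) fN(2), of "\<lambda>u. (x u)\<^sup>2"] x(2) by (simp add: sum_distrib_left[symmetric])
  finally have 1: "(?\<mu> + c) * (\<Sum>u\<in>?N. (x u)\<^sup>2) \<le> ?\<mu> + c - (real (card S) - d) * c"
    by (simp add: algebra_simps)
  have "(?\<mu> * x v)\<^sup>2 \<le> d * (\<Sum>u\<in>?N. (x u)\<^sup>2)"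
    using weighted_Cauchy_Schwarz[of ?N "\<lambda>_. 1" x] x(3)[OF v] by (simp add: d_def)
  then have "(?\<mu> + c) * (?\<mu> * x v)\<^sup>2 \<le> (?\<mu> + c) * (d * (\<Sum>u\<in>?N. (x u)\<^sup>2))"
    using assms(3,4) by (intro mult_left_mono) auto
  also have "\<dots> = d * ((?\<mu> + c) * (\<Sum>u\<in>?N. (x u)\<^sup>2))" by simp
  also have "\<dots> \<le> d * (?\<mu> + c - (real (card S) - d) * c)"
    using 1 by (intro mult_left_mono) (auto simp: d_def)
  finally have 2: "(?\<mu> + c) * (?\<mu> * x v)\<^sup>2 \<le> d * (?\<mu> + c - (real (card S) - d) * c)" .
  have "c * ?\<mu>\<^sup>2 \<le> ((?\<mu> + c) * (x v)\<^sup>2) * ?\<mu>\<^sup>2" using low[OF v] by (intro mult_right_mono) auto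
  also have "\<dots> = (?\<mu> + c) * (?\<mu> * x v)\<^sup>2" by (simp add: power_mult_distrib)
  finally show ?thesis using 2 by simp
qed

end

text \<open>This contradicts \<open>degree_of_local_max\<close> when the degree is at most (g - a)
  m. The margin at order m^2 is at least (7/16) g a m^2; as a m \<ge> 100, it absorbs all
  corrections, which are linear in m.\<close>

lemma local_max_degree_arith:
  fixes g a c \<mu> d m :: real
  assumes g: "1/2 \<le> g" "g \<le> 1" and a: "0 < a" "a \<le> 1/16" and c: "c = g * (1 - a)"
    and \<mu>: "g * m - 1/4 \<le> \<mu>" and d: "0 \<le> d" "d \<le> (g - a) * m"
    and m: "100 \<le> a * m * (1 - g)" "0 < m"
  shows "d * (\<mu> + c - (m - d) * c) < c * \<mu>\<^sup>2"
proof -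
  \<comment> \<open>The guaranteed lower bound on \<open>\<mu>\<close>; the 1/4 generously covers
    the error r/(4n) of the Turan value.\<close>
  define \<mu>0 where "\<mu>0 = g * m - 1/4"
  have "a * m * (1 - g) \<le> a * m * 1" using a g m by (intro mult_left_mono) auto
  then have am: "100 \<le> a * m" using m by simp
  have "a * m \<le> 1 * m" using a m by (intro mult_right_mono) auto
  then have m100: "100 \<le> m" using am by simp
  have "1/2 * m \<le> g * m" using g m by (intro mult_right_mono) auto
  then have gm: "m / 2 \<le> g * m" by simp
  then have \<mu>0: "\<mu>0 > 0" using m100 unfolding \<mu>0_def by linarith
  have c01: "0 < c" "c \<le> 1" using g a unfolding c by (auto intro: mult_le_one)
  have "(1 - a) * \<mu>0 \<le> 2 * g * ((1 - a) * \<mu>0)"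
    using g a \<mu>0 mult_right_mono[of 1 "2 * g" "(1 - a) * \<mu>0"] by simp
  also have "\<dots> = c * (\<mu>0 + \<mu>0)" by (simp add: c algebra_simps)
  also have "\<dots> \<le> c * (\<mu> + \<mu>0)" using c01 \<mu> by (intro mult_left_mono) (auto simp: \<mu>0_def)
  finally have 1: "(1 - a) * \<mu>0 \<le> c * (\<mu> + \<mu>0)" .
  have "d \<le> (1 - a) * \<mu>0"
  proof -
    have "(1 - a) * \<mu>0 = (g - a) * m + (a * m * (1 - g) - (1 - a) / 4)"
      by (simp add: \<mu>0_def algebra_simps)
    moreover have "0 \<le> a * m * (1 - g) - (1 - a) / 4" using m(1) a by simp
    ultimately show ?thesis using d(2) by (metis add_increasing2)
  qed
  \<comment> \<open>This product is the increase of c z^2 - d z from z = \<open>\<mu>0\<close> to z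
    = \<open>\<mu>\<close>, so it suffices to treat \<open>\<mu>0\<close>.\<close>
  then have "0 \<le> (\<mu> - \<mu>0) * (c * (\<mu> + \<mu>0) - d)"
    using 1 \<mu> by (intro mult_nonneg_nonneg) (auto simp: \<mu>0_def)
  then have f: "c * \<mu>0\<^sup>2 - d * \<mu>0 \<le> c * \<mu>\<^sup>2 - d * \<mu>"
    by (simp add: algebra_simps power2_eq_square)
  have f0: "c * \<mu>0\<^sup>2 - d * \<mu>0 \<ge> c * (g * m)\<^sup>2 - c * g * m / 2 - d * (g * m)"
    using c01 d by (simp add: \<mu>0_def power2_eq_square algebra_simps)
  have sq: "((g - a) * m)\<^sup>2 \<ge> d\<^sup>2" using d by (intro power_mono) auto
  have quarter: "d * (m - d) \<le> m\<^sup>2 / 4"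
    using zero_le_power2[of "m / 2 - d"] by (simp add: power2_eq_square algebra_simps)
  have gg: "3/4 \<le> 2 * g - g\<^sup>2"
  proof -
    have "(1 - g)\<^sup>2 \<le> (1/2)\<^sup>2" using g by (intro power_mono) auto
    then show ?thesis by (simp add: power2_eq_square algebra_simps)
  qed
  \<comment> \<open>The worst values are d = (g - a) m in the square and m^2/4 for d (m - d). The
    constant is 3/4 - 1/16 - 1/4 = 7/16.\<close>
  have "a * m\<^sup>2 * (7/16) \<le> a * m\<^sup>2 * (2 * g - a - g\<^sup>2 - 1/4)"
    using gg a m by (intro mult_left_mono) auto
  also have "\<dots> = (g * m)\<^sup>2 - ((g - a) * m)\<^sup>2 - a * ((g * m)\<^sup>2 + m\<^sup>2 / 4)"
    by (simp add: power2_eq_square algebra_simps)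
  also have "\<dots> \<le> (g * m)\<^sup>2 - d\<^sup>2 - a * ((g * m)\<^sup>2 + d * (m - d))"
    using sq quarter a by (intro diff_mono mult_left_mono add_left_mono) auto
  finally have br: "a * m\<^sup>2 * (7/16) \<le> (g * m)\<^sup>2 - d\<^sup>2 - a * ((g * m)\<^sup>2 + d * (m - d))" .
  have "100 * m * (7/16) \<le> a * m\<^sup>2 * (7/16)"
    using am m by (simp add: power2_eq_square mult_right_mono mult.assoc[symmetric])
  then have "40 * m \<le> (g * m)\<^sup>2 - d\<^sup>2 - a * ((g * m)\<^sup>2 + d * (m - d))" using br m by linarith
  then have "1/2 * (40 * m) \<le> g * ((g * m)\<^sup>2 - d\<^sup>2 - a * ((g * m)\<^sup>2 + d * (m - d)))"
    using g m by (intro mult_mono) auto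
  also have "\<dots> = c * (g * m)\<^sup>2 - d * (g * m) + c * (d * (m - d))"
    by (simp add: c power2_eq_square algebra_simps)
  finally have main: "20 * m \<le> c * (g * m)\<^sup>2 - d * (g * m) + c * (d * (m - d))" by simp
  have "c * g \<le> 1" using c01 g by (intro mult_le_one) auto
  then have e1: "c * g * m \<le> m" using m mult_right_mono[of "c * g" 1 m] by simp
  have "(g - a) * m \<le> 1 * m" using g a m by (intro mult_right_mono) auto
  then have "d \<le> m" using d by simp
  then have e2: "d * c \<le> m" using c01 d m mult_mono[of d m c 1] by simp
  have "d * (\<mu> + c - (m - d) * c) = d * \<mu> + d * c - c * (d * (m - d))"
    by (simp add: algebra_simps)
  then show ?thesis using f f0 main e1 e2 m by linarith
qed

section \<open>The spectral Turan theorem\<close>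

context adjacency
begin

text \<open>
  Erdos' degree majorisation: give one colour to all non-neighbours of a vertex of maximal weighted
  degree, and recurse into its neighbourhood.
\<close>

lemma degree_majorisation:
  assumes "finite S" "\<And>v. 0 \<le> w v" "cliques S (s + 1) = {}"
  shows "\<exists>col. (\<forall>u\<in>S. col u < s) \<and>
    (\<forall>u\<in>S. (\<Sum>v\<in>nbrs S u. w v) \<le> (\<Sum>v\<in>{v \<in> S. col v \<noteq> col u}. w v :: real))"
  using assms(1,3)
proof (induction s arbitrary: S)
  case 0
  have "S = {}"
  proof (rule ccontr)
    assume "S \<noteq> {}"
    then obtain v where "v \<in> S" by blast
    then have "{v} \<in> cliques S (0 + 1)" by (simp add: cliques_def)
    then show False using 0 by simp
  qed
  then show ?case by simp
next
  case (Suc s)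
  show ?case
  proof (cases "S = {}")
    case False
    let ?d = "\<lambda>u. \<Sum>v\<in>nbrs S u. w v"
    have "Max (?d ` S) \<in> ?d ` S" using Suc.prems False by (intro Max_in) auto
    then obtain v where v: "v \<in> S" "?d v = Max (?d ` S)" by auto
    have vmax: "?d u \<le> ?d v" if "u \<in> S" for u
      unfolding v(2) using Suc.prems that by (intro Max_ge) auto
    define B where "B = nbrs S v"
    have B: "finite B" "B \<subseteq> S" using Suc.prems nbrs_subset by (auto simp: B_def finite_nbrs)
    have "cliques B (s + 1) = {}"
    proof (rule ccontr)
      assume "cliques B (s + 1) \<noteq> {}"
      then obtain R where R: "R \<in> cliques B (s + 1)" by blast
      then have "R \<in> cliques S (s + 1)" using B by (auto simp: cliques_def)
      moreover have "v \<in> common S R"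
        using R v sym by (auto simp: cliques_def common_def B_def nbrs_def)
      ultimately show False using insert_cliques[OF Suc.prems(1)] Suc.prems(2) by fastforce
    qed
    then obtain col where col: "\<forall>u\<in>B. col u < s"
      "\<forall>u\<in>B. (\<Sum>v\<in>nbrs B u. w v) \<le> (\<Sum>v\<in>{v \<in> B. col v \<noteq> col u}. w v)"
      using Suc.IH[OF B(1)] by blast
    define c where "c = (\<lambda>u. if u \<in> B then col u else s)"
    have "?d u \<le> (\<Sum>v\<in>{v \<in> S. c v \<noteq> c u}. w v)" if u: "u \<in> S" for u
    proof (cases "u \<in> B")
      case True
      have "?d u \<le> (\<Sum>v\<in>nbrs B u \<union> (S - B). w v)"
        using Suc.prems B assms(2) by (intro sum_mono2) (auto simp: nbrs_def)
      also have "\<dots> = (\<Sum>v\<in>nbrs B u. w v) + (\<Sum>v\<in>S - B. w v)"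
        using Suc.prems B by (intro sum.union_disjoint) (auto simp: nbrs_def)
      also have "\<dots> \<le> (\<Sum>v\<in>{v \<in> B. col v \<noteq> col u}. w v) + (\<Sum>v\<in>S - B. w v)"
        using col(2) True by simp
      also have "\<dots> = (\<Sum>v\<in>{v \<in> B. col v \<noteq> col u} \<union> (S - B). w v)"
        using Suc.prems B by (intro sum.union_disjoint[symmetric]) auto
      also have "{v \<in> B. col v \<noteq> col u} \<union> (S - B) = {v \<in> S. c v \<noteq> c u}"
        using B True col(1) by (auto simp: c_def)
      finally show ?thesis .
    next
      case False
      then have "{v \<in> S. c v \<noteq> c u} = B" using B col(1) by (auto simp: c_def)
      then show ?thesis using vmax[OF u] by (simp add: B_def)
    qed
    moreover have "\<forall>u\<in>S. c u < Suc s" using col(1) by (auto simp: c_def less_Suc_eq)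
    ultimately show ?thesis by blast
  qed simp
qed

end

section \<open>Quadratic forms of complete multipartite graphs\<close>

lemma multipartite_form:
  fixes x :: "'a \<Rightarrow> real" and col :: "'a \<Rightarrow> nat"
  assumes "finite S" "\<And>v. v \<in> S \<Longrightarrow> col v < r"
  shows "(\<Sum>u\<in>S. x u * (\<Sum>v\<in>{v \<in> S. col v \<noteq> col u}. x v)) =
    (\<Sum>i<r. \<Sum>v\<in>{v \<in> S. col v = i}. x v)\<^sup>2 - (\<Sum>i<r. (\<Sum>v\<in>{v \<in> S. col v = i}. x v)\<^sup>2)"
proof -
  let ?s = "\<lambda>i. \<Sum>v\<in>{v \<in> S. col v = i}. x v"
  have grp: "(\<Sum>i<r. \<Sum>v\<in>{v \<in> S. col v = i}. f v) = (\<Sum>v\<in>S. f v)" for f :: "'a \<Rightarrow> real"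
    using assms by (intro sum.group) auto
  have "(\<Sum>v\<in>{v \<in> S. col v \<noteq> i}. x v) = (\<Sum>v\<in>S. x v) - ?s i" for i
  proof -
    have "(\<Sum>v\<in>S. x v) = (\<Sum>v\<in>{v \<in> S. col v = i} \<union> {v \<in> S. col v \<noteq> i}. x v)"
      by (intro sum.cong) auto
    also have "\<dots> = ?s i + (\<Sum>v\<in>{v \<in> S. col v \<noteq> i}. x v)"
      using assms(1) by (intro sum.union_disjoint) auto
    finally show ?thesis by simp
  qed
  then have "(\<Sum>u\<in>S. x u * (\<Sum>v\<in>{v \<in> S. col v \<noteq> col u}. x v)) =
      (\<Sum>u\<in>S. x u * (\<Sum>v\<in>S. x v)) - (\<Sum>u\<in>S. x u * ?s (col u))"
    by (simp add: right_diff_distrib sum_subtractf)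
  also have "(\<Sum>u\<in>S. x u * (\<Sum>v\<in>S. x v)) = (\<Sum>v\<in>S. x v)\<^sup>2"
    by (simp add: power2_eq_square sum_distrib_right)
  also have "(\<Sum>u\<in>S. x u * ?s (col u)) = (\<Sum>i<r. \<Sum>u\<in>{v \<in> S. col v = i}. x u * ?s (col u))"
    by (rule grp[symmetric])
  also have "\<dots> = (\<Sum>i<r. (?s i)\<^sup>2)"
    by (intro sum.cong) (auto simp: power2_eq_square sum_distrib_right)
  finally show ?thesis by (simp only: grp)
qed

text \<open>With at least two nonempty parts of sizes m_i, the largest eigenvalue of a complete
  multipartite graph is the positive \<mu> at which the m_i/(\<mu> + m_i) sum to 1;
  \<open>le1\<close> puts \<mu> at or above it. The class sums are written as s_i = a_i b_i with a_i
  = m_i/(\<mu> + m_i), and Cauchy-Schwarz is applied with the weights a_i. For an empty class a_i,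
  b_i and s_i are all 0.\<close>

lemma multipartite_form_le:
  fixes x :: "'a \<Rightarrow> real" and col :: "'a \<Rightarrow> nat"
  assumes S: "finite S" "\<And>v. v \<in> S \<Longrightarrow> col v < r" and "0 < \<mu>"
    and le1: "(\<Sum>i<r. real (card {v \<in> S. col v = i}) / (\<mu> + real (card {v \<in> S. col v = i}))) \<le> 1"
  shows "(\<Sum>u\<in>S. x u * (\<Sum>v\<in>{v \<in> S. col v \<noteq> col u}. x v)) \<le> \<mu> * (\<Sum>v\<in>S. (x v)\<^sup>2)"
proof -
  let ?V = "\<lambda>i. {v \<in> S. col v = i}"
  let ?s = "\<lambda>i. \<Sum>v\<in>?V i. x v" and ?m = "\<lambda>i. real (card (?V i))"
  let ?a = "\<lambda>i. ?m i / (\<mu> + ?m i)" and ?b = "\<lambda>i. ?s i * (\<mu> + ?m i) / ?m i"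
  have V0: "?V i = {}" if "?m i = 0" for i
    using that S(1) by (simp only: of_nat_eq_0_iff card_eq_0_iff) simp
  have s0: "?s i = 0" if "?m i = 0" for i
    using V0[OF that] by (simp only: sum.empty)
  have m0: "\<mu> + ?m i \<noteq> 0" for i using assms(3) by (simp add: add_nonneg_eq_0_iff)
  have ab: "?a i * ?b i = ?s i" for i
    using s0[of i] m0[of i] by (cases "?m i = 0") auto
  have ab2: "?a i * (?b i)\<^sup>2 \<le> (?s i)\<^sup>2 + \<mu> * (\<Sum>v\<in>?V i. (x v)\<^sup>2)" for i
  proof (cases "?m i = 0")
    case True
    show ?thesis unfolding V0[OF True] by simp
  next
    case False
    then have m: "?m i > 0" by simp
    have cs: "(?s i)\<^sup>2 \<le> ?m i * (\<Sum>v\<in>?V i. (x v)\<^sup>2)"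
      using weighted_Cauchy_Schwarz[of "?V i" "\<lambda>_. 1" x] by simp
    have "?a i * (?b i)\<^sup>2 = ?s i * ?b i" using ab[of i] by (simp add: power2_eq_square mult.assoc[symmetric])
    also have "\<dots> = (?s i)\<^sup>2 + \<mu> * ((?s i)\<^sup>2 / ?m i)"
      using False by (simp add: power2_eq_square field_simps)
    also have "\<dots> \<le> (?s i)\<^sup>2 + \<mu> * (\<Sum>v\<in>?V i. (x v)\<^sup>2)"
      using assms(3) cs m by (intro add_left_mono mult_left_mono) (auto simp: divide_le_eq mult.commute)
    finally show ?thesis .
  qed
  have "(\<Sum>i<r. ?s i)\<^sup>2 = (\<Sum>i<r. ?a i * ?b i)\<^sup>2" by (simp only: ab)
  also have "\<dots> \<le> (\<Sum>i<r. ?a i) * (\<Sum>i<r. ?a i * (?b i)\<^sup>2)"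
    using assms(3) by (intro weighted_Cauchy_Schwarz) auto
  also have "\<dots> \<le> 1 * (\<Sum>i<r. ?a i * (?b i)\<^sup>2)"
    using le1 assms(3) by (intro mult_right_mono sum_nonneg) auto
  also have "\<dots> \<le> (\<Sum>i<r. (?s i)\<^sup>2 + \<mu> * (\<Sum>v\<in>?V i. (x v)\<^sup>2))"
    using ab2 by (simp only: mult_1) (intro sum_mono)
  also have "\<dots> = (\<Sum>i<r. (?s i)\<^sup>2) + \<mu> * (\<Sum>i<r. \<Sum>v\<in>?V i. (x v)\<^sup>2)"
    by (simp add: sum.distrib sum_distrib_left)
  also have "(\<Sum>i<r. \<Sum>v\<in>?V i. (x v)\<^sup>2) = (\<Sum>v\<in>S. (x v)\<^sup>2)"
    using S by (intro sum.group) auto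
  finally show ?thesis using multipartite_form[of S col r x, OF S] by simp
qed

text \<open>
  The right-hand side is the chord of the concave function $m/(\mu + m)$ through $q$ and $q + 1$;
  it dominates at all integers $m$.
\<close>

lemma chord_inequality:
  fixes \<mu> :: real and m q :: nat
  assumes "0 < \<mu>"
  shows "real m / (\<mu> + real m) \<le> real q / (\<mu> + real q) + (real m - real q) * (\<mu> / ((\<mu> + real q) * (\<mu> + real q + 1)))"
    and "m = q \<or> m = q + 1 \<Longrightarrow>
      real m / (\<mu> + real m) = real q / (\<mu> + real q) + (real m - real q) * (\<mu> / ((\<mu> + real q) * (\<mu> + real q + 1)))"
proof -
  define k where "k = real m - real q"
  define b where "b = \<mu> + real q"
  have b: "b > 0" "b + k > 0" "b + 1 > 0" using assms by (auto simp: b_def k_def add_pos_nonneg)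
  have m: "\<mu> + real m = b + k" "\<mu> + real q = b" "real q = b - \<mu>" "real m = b + k - \<mu>"
    by (auto simp: b_def k_def)
  have eq: "real q / (\<mu> + real q) + (real m - real q) * (\<mu> / ((\<mu> + real q) * (\<mu> + real q + 1)))
      - real m / (\<mu> + real m) = \<mu> * (k * (k - 1)) / (b * (b + 1) * (b + k))"
    unfolding m using b by (simp add: divide_simps) (simp add: algebra_simps)
  have "0 \<le> k * (k - 1)"
  proof (cases "m \<le> q")
    case True
    then show ?thesis by (intro mult_nonpos_nonpos) (auto simp: k_def)
  next
    case False
    then have "real m \<ge> real q + 1" by linarith
    then show ?thesis by (intro mult_nonneg_nonneg) (auto simp: k_def)
  qed
  then have "0 \<le> \<mu> * (k * (k - 1)) / (b * (b + 1) * (b + k))" using b assms by simp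
  then show "real m / (\<mu> + real m) \<le> real q / (\<mu> + real q) + (real m - real q) * (\<mu> / ((\<mu> + real q) * (\<mu> + real q + 1)))"
    using eq by linarith
  assume "m = q \<or> m = q + 1"
  then have "\<mu> * (k * (k - 1)) / (b * (b + 1) * (b + k)) = 0" by (auto simp: k_def)
  then show "real m / (\<mu> + real m) = real q / (\<mu> + real q) + (real m - real q) * (\<mu> / ((\<mu> + real q) * (\<mu> + real q + 1)))"
    using eq by linarith
qed

text \<open>The chord is affine, so its sum depends only on the total, which \<open>f\<close> and
  \<open>g\<close> share. It lies above every term of \<open>f\<close> and agrees with the terms of
  \<open>g\<close>.\<close>

lemma balanced_sum_max:
  fixes \<mu> :: real and f g :: "nat \<Rightarrow> nat"
  assumes "0 < \<mu>" "(\<Sum>i<r. f i) = (\<Sum>i<r. g i)" "\<And>i. i < r \<Longrightarrow> g i \<in> {q, q + 1}"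
  shows "(\<Sum>i<r. real (f i) / (\<mu> + real (f i))) \<le> (\<Sum>i<r. real (g i) / (\<mu> + real (g i)))"
proof -
  let ?k = "\<mu> / ((\<mu> + real q) * (\<mu> + real q + 1))"
  have "(\<Sum>i<r. real (f i) / (\<mu> + real (f i))) \<le> (\<Sum>i<r. real q / (\<mu> + real q) + (real (f i) - real q) * ?k)"
    by (intro sum_mono chord_inequality(1)[OF assms(1)])
  also have "\<dots> = (\<Sum>i<r. real q / (\<mu> + real q) + (real (g i) - real q) * ?k)"
  proof -
    have "(\<Sum>i<r. real (f i)) = (\<Sum>i<r. real (g i))" using assms(2) by (metis of_nat_sum)
    then show ?thesis by (simp only: sum.distrib sum_distrib_right[symmetric] sum_subtractf)
  qed
  also have "\<dots> = (\<Sum>i<r. real (g i) / (\<mu> + real (g i)))"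
    using assms(3) by (intro sum.cong refl chord_inequality(2)[OF assms(1), symmetric]) auto
  finally show ?thesis .
qed

section \<open>From graphs and their matrices to the relation on vertices\<close>

lemma adjacency_graph:
  assumes "graph G"
  shows "adjacency (dominates G)"
proof -
  interpret graph G by fact
  show ?thesis
  proof
    show "dominates G v u" if "dominates G u v" for u v
      using that sym_arcs by (auto simp: symmetric_def dest: symD)
    show "\<not> dominates G u u" for u
      using adj_not_same by blast
  qed
qed

text \<open>The nonnegative maximiser makes \<open>lam\<close> an eigenvalue, and every eigenvalue
  is the Rayleigh quotient of its eigenvector.\<close>

lemma mu_eq_lam:
  assumes "graph G" "verts G \<noteq> {}"
  shows "mu G = adjacency.lam (dominates G) (verts G)"
proof -
  interpret graph G by fact
  interpret adjacency "dominates G" by (rule adjacency_graph[OF assms(1)])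
  obtain vs where vs: "set vs = verts G" "distinct vs"
    using finite_distinct_list[OF finite_verts] by blast
  have ev: "eigenvalue (adjacency_mat G vs) k \<longleftrightarrow>
    (\<exists>f. (\<exists>v\<in>verts G. f v \<noteq> 0) \<and> (\<forall>u\<in>verts G. (\<Sum>v\<in>nbrs (verts G) u. f v) = k * f u))" for k
  proof -
    have "(\<Sum>v\<in>verts G. (if dominates G u v then 1 else 0) * f v) = (\<Sum>v\<in>nbrs (verts G) u. f v)"
      for u and f :: "'a \<Rightarrow> real"
      unfolding sum_nbrs[OF finite_verts] by (intro sum.cong) auto
    then show ?thesis by (simp add: eigenvalue_adjacency_mat[OF vs(2)] vs(1))
  qed
  have "finite (spectrum (adjacency_mat G vs))"
    by (rule card_finite_spectrum[of _ "length vs"]) (simp add: adjacency_mat_def)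
  moreover have "lam (verts G) \<in> spectrum (adjacency_mat G vs)"
  proof -
    obtain x where x: "\<And>u. 0 \<le> x u" "(\<Sum>u\<in>verts G. (x u)\<^sup>2) = 1"
      "\<And>u. u \<in> verts G \<Longrightarrow> (\<Sum>v\<in>nbrs (verts G) u. x v) = lam (verts G) * x u"
      using ex_nonneg_eigenvector[OF finite_verts assms(2)] by blast
    have "\<exists>v\<in>verts G. x v \<noteq> 0"
    proof (rule ccontr)
      assume "\<not> ?thesis"
      then have "(\<Sum>u\<in>verts G. (x u)\<^sup>2) = 0" by (intro sum.neutral) auto
      then show False using x(2) by simp
    qed
    then have "eigenvalue (adjacency_mat G vs) (lam (verts G))" unfolding ev using x(3) by blast
    then show ?thesis by (simp add: spectrum_def)
  qed
  moreover have "k \<le> lam (verts G)" if "k \<in> spectrum (adjacency_mat G vs)" for k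
  proof -
    have "eigenvalue (adjacency_mat G vs) k" using that by (simp add: spectrum_def)
    then obtain f where f: "\<exists>v\<in>verts G. f v \<noteq> 0"
      "\<forall>u\<in>verts G. (\<Sum>v\<in>nbrs (verts G) u. f v) = k * f u" unfolding ev by blast
    have "quad (verts G) f = (\<Sum>u\<in>verts G. k * (f u)\<^sup>2)"
      unfolding quad_def using f(2) by (intro sum.cong) (auto simp: power2_eq_square)
    then have "quad (verts G) f = k * (\<Sum>u\<in>verts G. (f u)\<^sup>2)"
      by (simp only: sum_distrib_left)
    moreover have "(\<Sum>u\<in>verts G. (f u)\<^sup>2) > 0"
    proof -
      obtain v where v: "v \<in> verts G" "f v \<noteq> 0" using f(1) by blast
      show ?thesis using v by (intro sum_pos2[of _ v]) auto
    qed
    ultimately show ?thesis using quad_le_lam[OF finite_verts assms(2), of f] by simp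
  qed
  ultimately show ?thesis
    unfolding mu_eq_enumeration[OF vs(2,1)] by (intro Max_eqI)
qed

section \<open>The largest eigenvalue of the Turan graph\<close>

definition turan_part :: "nat \<Rightarrow> nat \<Rightarrow> nat \<Rightarrow> nat" where
  "turan_part r n i = card {v \<in> {..<n}. v mod r = i}"

lemma turan_part_balanced: "i < r \<Longrightarrow> turan_part r n i \<in> {n div r, n div r + 1}"
  using turan_graph_balanced[of i r n] by (simp add: turan_part_def turan_graph_complete_multipartite)

lemma sum_turan_part:
  assumes "0 < r"
  shows "(\<Sum>i<r. turan_part r n i) = n"
proof -
  have "(\<Sum>i<r. \<Sum>v\<in>{v \<in> {..<n}. v mod r = i}. 1::nat) = (\<Sum>v\<in>{..<n}. 1)"
    using assms by (intro sum.group) auto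
  then show ?thesis by (simp add: turan_part_def)
qed

text \<open>The Rayleigh bound for vectors that are constant on the parts. It is used for the
  all-ones vector, which gives \<open>mu_turan_graph_ge\<close>, and for the Perron vector in
  \<open>turan_fractions_le_1\<close>.\<close>

lemma turan_form_le:
  assumes "0 < r" "0 < n"
  shows "(\<Sum>i<r. real (turan_part r n i) * y i)\<^sup>2 - (\<Sum>i<r. (real (turan_part r n i) * y i)\<^sup>2)
    \<le> mu (turan_graph r n) * (\<Sum>i<r. real (turan_part r n i) * (y i)\<^sup>2)"
proof -
  let ?T = "turan_graph r n" and ?V = "{..<n}"
  interpret adjacency "dominates ?T" by (rule adjacency_graph[OF graph_turan_graph])
  have T: "verts ?T = ?V" "?V \<noteq> {}" using assms by (auto simp: turan_graph_complete_multipartite)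
  let ?x = "\<lambda>v. y (v mod r) :: real"
  have nb: "nbrs ?V u = {v \<in> ?V. v mod r \<noteq> u mod r}" if "u \<in> ?V" for u
    unfolding nbrs_def unfolding turan_graph_complete_multipartite using that by auto
  have part: "(\<Sum>v\<in>{v \<in> ?V. v mod r = i}. ?x v) = real (turan_part r n i) * y i" for i
    by (simp add: turan_part_def)
  have "quad ?V ?x = (\<Sum>u\<in>?V. ?x u * (\<Sum>v\<in>{v \<in> ?V. v mod r \<noteq> u mod r}. ?x v))"
    unfolding quad_def by (intro sum.cong refl) (simp only: nb)
  also have "\<dots> = (\<Sum>i<r. real (turan_part r n i) * y i)\<^sup>2 - (\<Sum>i<r. (real (turan_part r n i) * y i)\<^sup>2)"
    using assms by (subst multipartite_form[where r = r]) (auto simp only: part finite_lessThan mod_less_divisor)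
  finally have q: "quad ?V ?x = \<dots>" .
  have "(\<Sum>v\<in>?V. (?x v)\<^sup>2) = (\<Sum>i<r. \<Sum>v\<in>{v \<in> ?V. v mod r = i}. (?x v)\<^sup>2)"
    using assms by (intro sum.group[symmetric]) auto
  also have "\<dots> = (\<Sum>i<r. real (turan_part r n i) * (y i)\<^sup>2)"
    by (simp add: turan_part_def)
  finally have n: "(\<Sum>v\<in>?V. (?x v)\<^sup>2) = \<dots>" .
  have "mu ?T = lam ?V" using mu_eq_lam[OF graph_turan_graph, of r n] T by simp
  then show ?thesis using quad_le_lam[OF _ T(2), of ?x] q n by simp
qed

text \<open>The eigenvalue is at least the average degree. Part sizes p satisfy (p - q) (p - q - 1)
  = 0 with q = n div r, so the sum of their squares is determined by n, r and q.\<close>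

lemma mu_turan_graph_ge:
  assumes "0 < r" "0 < n"
  shows "mu (turan_graph r n) \<ge> (1 - 1 / real r) * real n - real r / (4 * real n)"
proof -
  let ?p = "\<lambda>i. real (turan_part r n i)" and ?q = "real (n div r)"
  have sum: "(\<Sum>i<r. ?p i) = real n" using sum_turan_part[OF assms(1), of n] by (metis of_nat_sum)
  have "(?p i)\<^sup>2 = (2 * ?q + 1) * ?p i - ?q * (?q + 1)" if "i < r" for i
  proof -
    have "?p i = ?q \<or> ?p i = ?q + 1" using turan_part_balanced[OF that, of n] by auto
    then show ?thesis by (auto simp: power2_eq_square algebra_simps)
  qed
  then have "(\<Sum>i<r. (?p i)\<^sup>2) = (\<Sum>i<r. (2 * ?q + 1) * ?p i - ?q * (?q + 1))"
    by (intro sum.cong) auto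
  also have "\<dots> = (2 * ?q + 1) * real n - real r * (?q * (?q + 1))"
    by (simp add: sum_subtractf sum_distrib_left[symmetric] sum)
  \<comment> \<open>Completing the square in q. The error r/4 is reached when n/r lies midway
    between q and q + 1.\<close>
  also have "\<dots> = (real n)\<^sup>2 / real r + real r / 4 - real r * (real n / real r - ?q - 1/2)\<^sup>2"
    using assms by (simp add: power2_eq_square field_simps)
  also have "\<dots> \<le> (real n)\<^sup>2 / real r + real r / 4" by simp
  finally have sq: "(\<Sum>i<r. (?p i)\<^sup>2) \<le> (real n)\<^sup>2 / real r + real r / 4" .
  have "(real n)\<^sup>2 - (\<Sum>i<r. (?p i)\<^sup>2) \<le> mu (turan_graph r n) * real n"
    using turan_form_le[OF assms, of "\<lambda>_. 1"] sum by simp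
  then have "(real n)\<^sup>2 - (real n)\<^sup>2 / real r - real r / 4 \<le> mu (turan_graph r n) * real n"
    using sq by linarith
  then have "((real n)\<^sup>2 - (real n)\<^sup>2 / real r - real r / 4) / real n \<le> mu (turan_graph r n)"
    using assms by (simp add: pos_divide_le_eq)
  moreover have "((real n)\<^sup>2 - (real n)\<^sup>2 / real r - real r / 4) / real n =
      (1 - 1 / real r) * real n - real r / (4 * real n)"
    using assms by (simp add: power2_eq_square field_simps)
  ultimately show ?thesis by simp
qed

text \<open>Test vector: $1/(\mu + n_i)$ on the part of size $n_i$ is the Perron vector of the Turan graph.\<close>

lemma turan_fractions_le_1:
  assumes "0 < r" "0 < n" "0 < mu (turan_graph r n)"
  shows "(\<Sum>i<r. real (turan_part r n i) / (mu (turan_graph r n) + real (turan_part r n i))) \<le> 1"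
proof -
  let ?p = "\<lambda>i. real (turan_part r n i)" and ?\<mu> = "mu (turan_graph r n)"
  let ?y = "\<lambda>i. 1 / (?\<mu> + ?p i)"
  define s where "s = (\<Sum>i<r. ?p i * ?y i)"
  have "s\<^sup>2 \<le> (\<Sum>i<r. (?p i * ?y i)\<^sup>2) + ?\<mu> * (\<Sum>i<r. ?p i * (?y i)\<^sup>2)"
    using turan_form_le[OF assms(1,2), of ?y] by (simp add: s_def)
  also have "\<dots> = (\<Sum>i<r. (?p i * ?y i)\<^sup>2 + ?\<mu> * (?p i * (?y i)\<^sup>2))"
    by (simp only: sum.distrib sum_distrib_left)
  also have "\<dots> = s"
    unfolding s_def
  proof (rule sum.cong[OF refl])
    fix i
    have "?\<mu> + ?p i \<noteq> 0" using assms(3) by (simp add: add_nonneg_eq_0_iff)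
    then have "(?\<mu> + ?p i) * ?y i = 1" by simp
    moreover have "(?p i * ?y i)\<^sup>2 + ?\<mu> * (?p i * (?y i)\<^sup>2) = ?p i * ?y i * ((?\<mu> + ?p i) * ?y i)"
    proof -
      have "(p * y)\<^sup>2 + m * (p * y\<^sup>2) = p * y * ((m + p) * y)" for p y m :: real
        by (simp add: power2_eq_square algebra_simps)
      then show ?thesis .
    qed
    ultimately show "(?p i * ?y i)\<^sup>2 + ?\<mu> * (?p i * (?y i)\<^sup>2) = ?p i * ?y i" by simp
  qed
  finally have "s * s \<le> 1 * s" by (simp add: power2_eq_square)
  then have "s \<le> 1" using mult_strict_right_mono[of 1 s s] by linarith
  then show ?thesis by (simp add: s_def)
qed

context adjacency
begin

text \<open>With the Perron vector as weights, the majorisation can be multiplied by x_u \<ge> 0 and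
  summed, so \<open>lam S\<close> is at most the form of a complete r-partite graph at the same
  vector. Balanced parts maximise the sum of the m_i/(\<mu> + m_i), and for them it is at most
  1.\<close>

lemma spectral_Turan:
  assumes "finite S" "card S = n" "0 < n" "0 < r" "0 < mu (turan_graph r n)"
    and "cliques S (r + 1) = {}"
  shows "lam S \<le> mu (turan_graph r n)"
proof -
  let ?\<mu> = "mu (turan_graph r n)"
  have ne: "S \<noteq> {}" using assms by auto
  obtain x where x: "\<And>u. 0 \<le> x u" "(\<Sum>u\<in>S. (x u)\<^sup>2) = 1"
    "\<And>u. u \<in> S \<Longrightarrow> (\<Sum>v\<in>nbrs S u. x v) = lam S * x u"
    using ex_nonneg_eigenvector[OF assms(1) ne] by blast
  obtain col where col: "\<forall>u\<in>S. col u < r"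
    "\<forall>u\<in>S. (\<Sum>v\<in>nbrs S u. x v) \<le> (\<Sum>v\<in>{v \<in> S. col v \<noteq> col u}. x v)"
    using degree_majorisation[OF assms(1), where w = x and s = r] x(1) assms(6) by blast
  let ?f = "\<lambda>i. card {v \<in> S. col v = i}"
  have "(\<Sum>i<r. ?f i) = (\<Sum>i<r. turan_part r n i)"
  proof -
    have "(\<Sum>i<r. \<Sum>v\<in>{v \<in> S. col v = i}. 1::nat) = (\<Sum>v\<in>S. 1)"
      using assms(1) col(1) by (intro sum.group) auto
    then show ?thesis using assms sum_turan_part[OF assms(4), of n] by simp
  qed
  then have "(\<Sum>i<r. real (?f i) / (?\<mu> + real (?f i))) \<le>
      (\<Sum>i<r. real (turan_part r n i) / (?\<mu> + real (turan_part r n i)))"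
    using turan_part_balanced by (intro balanced_sum_max[OF assms(5), where q = "n div r"]) auto
  also have "\<dots> \<le> 1" using assms by (intro turan_fractions_le_1)
  finally have le1: "(\<Sum>i<r. real (?f i) / (?\<mu> + real (?f i))) \<le> 1" .
  have "lam S * (\<Sum>u\<in>S. (x u)\<^sup>2) = (\<Sum>u\<in>S. x u * (lam S * x u))"
    unfolding sum_distrib_left by (intro sum.cong) (auto simp: power2_eq_square)
  then have "lam S = (\<Sum>u\<in>S. x u * (lam S * x u))"
    using x(2) by simp
  also have "\<dots> = (\<Sum>u\<in>S. x u * (\<Sum>v\<in>nbrs S u. x v))"
    using x(3) by (intro sum.cong) auto
  also have "\<dots> \<le> (\<Sum>u\<in>S. x u * (\<Sum>v\<in>{v \<in> S. col v \<noteq> col u}. x v))"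
    using col(2) x(1) by (intro sum_mono mult_left_mono) auto
  also have "\<dots> \<le> ?\<mu> * (\<Sum>v\<in>S. (x v)\<^sup>2)"
    using col(1) by (intro multipartite_form_le[OF assms(1) _ assms(5) le1]) auto
  finally show ?thesis using x(2) by simp
qed

text \<open>The spectral hypothesis enters as an explicit lower bound on \<open>lam V\<close>
  together with one (r+1)-clique. Here \<open>t\<close> is any bound on the number of (r+1)-cliques
  through an edge, so joints appear only when it is instantiated.\<close>

lemma large_joint:
  assumes V: "finite V" "card V = n" and r: "2 \<le> r" and n: "r ^ 15 < n"
    and lamV: "lam V > (1 - 1 / real r) * real n - real r / (4 * real n)"
    and cl: "cliques V (r + 1) \<noteq> {}"
    and t: "0 \<le> t" "\<And>u v. u \<in> V \<Longrightarrow> v \<in> V \<Longrightarrow> E u v \<Longrightarrow>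
      real (card {Q \<in> cliques V (r + 1). u \<in> Q \<and> v \<in> Q}) \<le> t"
  shows "real n ^ (r - 1) / real r ^ (2 * r + 4) < t"
proof -
  let ?r = "real r" and ?n = "real n"
  define g where "g = 1 - 1 / ?r"
  define a where "a = 1 / ?r ^ 4"
  define c where "c = g * (1 - a)"
  define M where "M = (n + 1) div 2"
  have r2: "?r \<ge> 2" using r by simp
  have g: "1/2 \<le> g" "g \<le> 1" and g3: "1 - g = 1 / ?r" and g4: "g = (?r - 1) / ?r"
    using r2 by (auto simp: g_def field_simps)
  have r4: "?r ^ 4 \<ge> 16" using power_mono[OF r2, of 4] by simp
  have a: "0 < a" "a \<le> 1/16" using r4 r2 by (auto simp: a_def field_simps)
  have c: "0 < c" "g - c = g * a" using g(1) a by (auto simp: c_def algebra_simps)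
  have rn: "?r ^ 15 < ?n" using n by (metis of_nat_less_iff of_nat_power)
  have pw: "2 ^ k \<le> ?r ^ k" for k using r2 by (intro power_mono) auto
  have an: "a * ?n \<ge> 2048"
  proof -
    have "2048 \<le> ?r ^ 11" using pw[of 11] by simp
    also have "\<dots> = a * ?r ^ 15" using r2 by (simp add: a_def field_simps flip: power_add)
    also have "\<dots> \<le> a * ?n" using rn a by (intro mult_left_mono) auto
    finally show ?thesis .
  qed
  \<comment> \<open>The exponent 15 is used here: n/r^5 exceeds r^10 \<ge> 2^10. Halved for m \<ge>
    n/2, this supplies the bound 100 of \<open>local_max_degree_arith\<close>.\<close>
  have anr: "a * ?n * (1 - g) \<ge> 1024"
  proof -
    have "1024 \<le> ?r ^ 10" using pw[of 10] by simp
    also have "\<dots> = ?r ^ 15 / ?r ^ 5" using r2 by (simp add: field_simps flip: power_add)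
    also have "\<dots> \<le> ?n / ?r ^ 5" using rn by (intro divide_right_mono) auto
    also have "\<dots> = a * ?n * (1 - g)" by (simp add: a_def g3 field_simps flip: power_Suc)
    finally show ?thesis .
  qed
  have npos: "?n > 0" "n > 0" using rn r2 by (auto intro: order.strict_trans[rotated])
  have eps: "?r / (4 * ?n) \<le> a / 4" "0 \<le> ?r / (4 * ?n)"
  proof -
    have "?r ^ 5 \<le> ?r ^ 15" using r2 by (intro power_increasing) auto
    then have "?r ^ 5 \<le> ?n" using rn by linarith
    then have "?r * ?r ^ 4 \<le> ?n" by (simp flip: power_Suc)
    then show "?r / (4 * ?n) \<le> a / 4" using npos r2 by (simp add: a_def field_simps)
  qed (use npos in auto)
  have M: "?n / 2 \<le> real M" "real M \<le> (?n + 1) / 2" "M \<le> n"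
  proof -
    have "n \<le> 2 * M" "2 * M \<le> n + 1" unfolding M_def by presburger+
    then show "?n / 2 \<le> real M" "real M \<le> (?n + 1) / 2" "M \<le> n"
      using npos(2) by auto
  qed
  define F where "F = {S. S \<subseteq> V \<and> M \<le> card S}"
  have F: "finite F" "V \<in> F" using V M by (auto simp: F_def)
  let ?pot = "\<lambda>S. lam S - c * real (card S)"
  have "Max (?pot ` F) \<in> ?pot ` F" using F by (intro Max_in) auto
  then obtain S where S: "S \<in> F" "?pot S = Max (?pot ` F)" by auto
  have Smax: "?pot T \<le> ?pot S" if "T \<in> F" for T
    unfolding S(2) using F that by (intro Max_ge) auto
  define m where "m = real (card S)"
  have SV: "S \<subseteq> V" "finite S" "M \<le> card S" using S V by (auto simp: F_def intro: finite_subset)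
  have mn: "?n / 2 \<le> m" "m \<le> ?n"
    using M SV card_mono[OF V(1) SV(1)] V(2) by (auto simp: m_def)
  have ne: "S \<noteq> {}" using mn npos by (auto simp: m_def)
  have lamS: "lam S > g * m + g * a * (?n - m) - ?r / (4 * ?n)"
  proof -
    have "lam V - c * ?n \<le> lam S - c * m" using Smax[OF F(2)] V by (simp add: m_def)
    then have "g * ?n - ?r / (4 * ?n) - c * ?n + c * m < lam S" using lamV by (simp add: g_def)
    moreover have "g * ?n - c * ?n + c * m = g * m + (g - c) * (?n - m)" by (simp add: algebra_simps)
    ultimately show ?thesis unfolding c(2) by linarith
  qed
  have tS: "real (card {Q \<in> cliques S (r + 1). u \<in> Q \<and> v \<in> Q}) \<le> t"
    if "u \<in> S" "v \<in> S" "E u v" for u v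
  proof -
    have "cliques S (r + 1) \<subseteq> cliques V (r + 1)" using SV(1) by (auto simp: cliques_def)
    then have "card {Q \<in> cliques S (r + 1). u \<in> Q \<and> v \<in> Q} \<le> card {Q \<in> cliques V (r + 1). u \<in> Q \<and> v \<in> Q}"
      using finite_cliques[OF V(1)] by (intro card_mono) auto
    then show ?thesis using t(2)[of u v] that SV by fastforce
  qed
  have half: "(?n / 2) ^ (r - 1) = ?n ^ (r - 1) / 2 ^ (r - 1)" by (rule power_divide)
  have split: "?r ^ (2 * r + 4) = ?r ^ r * ?r ^ (r + 2) * ?r ^ 2"
  proof -
    have "2 * r + 4 = r + (r + 2) + 2" by simp
    then show ?thesis by (simp only: power_add)
  qed
  show ?thesis
  proof (cases "card S = M")
    case True
    \<comment> \<open>As m \<le> (n + 1)/2, the surplus (3/4) g a m leaves at least g a (n - 7)/8 of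
      the gain g a (n - m) to absorb the error r/(4n).\<close>
    define h where "h = 3/4 * (g * a)"
    have ga: "0 < g * a" using g a by simp
    have "?r / (4 * ?n) \<le> 1" using eps a by linarith
    also have "1 \<le> g * a * (?n - 7) / 8"
    proof -
      have "1/2 * 16 \<le> g * (a * ?n - 7 * a)" using g a an by (intro mult_mono) auto
      then show ?thesis by (simp add: algebra_simps)
    qed
    also have "g * a * (?n - 7) / 8 \<le> g * a * (?n - m) - h * m"
    proof -
      have "(?n - 7) / 8 \<le> (?n - m) - 3/4 * m" using M True by (simp add: m_def)
      then have "g * a * ((?n - 7) / 8) \<le> g * a * ((?n - m) - 3/4 * m)"
        using ga by (intro mult_left_mono) auto
      then show ?thesis by (simp add: h_def algebra_simps)
    qed
    finally have lam1: "lam S \<ge> (g + h) * m" using lamS by (simp add: algebra_simps)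
    have lam2: "lam S \<ge> g * (?n / 2)"
    proof -
      have "g * (?n / 2) \<le> g * m" using mn g by (intro mult_left_mono) auto
      also have "\<dots> \<le> (g + h) * m" using ga mn npos by (intro mult_right_mono) (auto simp: h_def)
      finally show ?thesis using lam1 by simp
    qed
    have "?r ^ 2 * h * lam S ^ (r - 1) \<le> t * ?r ^ r"
      by (rule joint_of_lam[OF SV(2) ne r _ _ t(1) tS])
        (use ga lam1 in \<open>auto simp: h_def g_def m_def\<close>)
    moreover have "?r ^ 2 * h * (g * (?n / 2)) ^ (r - 1) \<le> ?r ^ 2 * h * lam S ^ (r - 1)"
      using lam2 g npos ga by (intro mult_left_mono power_mono) (auto simp: h_def)
    ultimately have low: "?r ^ 2 * h * (g * (?n / 2)) ^ (r - 1) \<le> t * ?r ^ r" by linarith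
    have gr: "g * g ^ (r - 1) = (?r - 1) ^ r / ?r ^ r"
    proof -
      have "g * g ^ (r - 1) = g ^ r" using r by (metis One_nat_def Suc_pred' less_le_trans pos2 power_Suc)
      then show ?thesis unfolding g4 by (simp add: power_divide)
    qed
    have "?r ^ 2 * h * (g * (?n / 2)) ^ (r - 1) =
        3/4 * (?r ^ 2 * a) * (g * g ^ (r - 1)) * (?n / 2) ^ (r - 1)"
      unfolding h_def power_mult_distrib by simp
    also have "?r ^ 2 * a = 1 / ?r ^ 2" using r2 by (simp add: a_def power2_eq_square power4_eq_xxxx)
    finally have e: "?r ^ 2 * h * (g * (?n / 2)) ^ (r - 1) =
        3/4 * (?r - 1) ^ r / 2 ^ (r - 1) * (?n ^ (r - 1) / (?r ^ r * ?r ^ 2))"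
      unfolding gr half by simp
    \<comment> \<open>The tight case is r = 2, with 3/8 against 1/4; for larger r the left-hand side
      is at least 3/2.\<close>
    have num: "3/4 * (?r - 1) ^ r / 2 ^ (r - 1) > 1 / ?r ^ 2"
    proof (cases "r = 2")
      case False
      then have "?r - 1 \<ge> 2" using r by linarith
      then have "2 ^ r \<le> (?r - 1) ^ r" by (intro power_mono) auto
      moreover have "(2::real) ^ r = 2 * 2 ^ (r - 1)" using r by (metis One_nat_def Suc_pred' less_le_trans pos2 power_Suc)
      ultimately have "3/2 \<le> 3/4 * (?r - 1) ^ r / 2 ^ (r - 1)" by (simp add: field_simps)
      moreover have "1 / ?r ^ 2 \<le> 1" using r2 by simp
      ultimately show ?thesis by linarith
    qed simp
    have "1 / ?r ^ 2 * (?n ^ (r - 1) / (?r ^ r * ?r ^ 2)) <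
        3/4 * (?r - 1) ^ r / 2 ^ (r - 1) * (?n ^ (r - 1) / (?r ^ r * ?r ^ 2))"
      using num npos r2 by (intro mult_strict_right_mono) auto
    also have "\<dots> \<le> t * ?r ^ r" using low e by simp
    finally have "1 / ?r ^ 2 * (?n ^ (r - 1) / (?r ^ r * ?r ^ 2)) / ?r ^ r < t"
      using r2 by (simp add: pos_divide_less_eq mult_ac)
    moreover have "1 / ?r ^ 2 * (?n ^ (r - 1) / (?r ^ r * ?r ^ 2)) / ?r ^ r = ?n ^ (r - 1) / ?r ^ (2 * r + 4)"
      unfolding split by (simp add: power_add power2_eq_square)
    ultimately show ?thesis by (simp only:)
  next
    case False
    then have big: "M < card S" using SV by simp
    have lam0: "lam S \<ge> g * m - 1/4"
    proof -
      have "0 \<le> g * a * (?n - m)" using g a mn by simp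
      then show ?thesis using lamS eps a by linarith
    qed
    have m1: "a * m * (1 - g) \<ge> 100"
    proof -
      have "a * (?n / 2) * (1 - g) \<le> a * m * (1 - g)"
        using a g mn by (intro mult_right_mono mult_left_mono) auto
      then show ?thesis using anr by simp
    qed
    have m0: "m > 0" using mn npos by linarith
    have m2: "2 \<le> card S"
    proof -
      have "?n \<ge> 2048" using an a mult_right_mono[of a 1 ?n] npos by linarith
      then have "2 \<le> m" using mn by linarith
      then show ?thesis by (simp add: m_def)
    qed
    have gm: "1/2 * m \<le> g * m" using g m0 by (intro mult_right_mono) auto
    have "2 \<le> m" using m2 by (simp add: m_def)
    then have lampos: "0 < lam S" using lam0 gm by linarith
    have loc: "lam (S - {v}) \<le> lam S - c" if "v \<in> S" for v
    proof -
      have "S - {v} \<in> F" using SV big that by (auto simp: F_def)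
      from Smax[OF this] show ?thesis using that SV m2 by (simp add: of_nat_diff algebra_simps)
    qed
    have deg: "(1 - 1 / ?r - 1 / ?r ^ 4) * real (card S) \<le> real (card (nbrs S v))" if v: "v \<in> S" for v
    proof (rule ccontr)
      assume "\<not> ?thesis"
      then have "real (card (nbrs S v)) \<le> (g - a) * m" by (simp add: g_def a_def m_def)
      then have "real (card (nbrs S v)) * (lam S + c - (m - real (card (nbrs S v))) * c) < c * (lam S)\<^sup>2"
        using g a lam0 m1 m0 by (intro local_max_degree_arith[where g = g and a = a]) (auto simp: c_def)
      then show False
        using degree_of_local_max[OF SV(2) m2 c(1) lampos loc v] by (simp add: m_def)
    qed
    \<comment> \<open>One missing vertex already adds g a \<ge> a/2, more than the error r/(4n)
      \<le> a/4, so Wilf's bound applies. For \<open>S = V\<close> the value \<open>lam V\<close>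
      may lie below g n, and the clique comes from \<open>cl\<close>.\<close>
    have clS: "cliques S (r + 1) \<noteq> {}"
    proof (cases "S = V")
      case False
      then have "card S < n" using V SV by (metis psubsetI psubset_card_mono)
      then have "1 \<le> ?n - m" unfolding m_def by linarith
      then have "g * a * 1 \<le> g * a * (?n - m)" using g a by (intro mult_left_mono) auto
      moreover have "1/2 * a \<le> g * a" using g a by (intro mult_right_mono) auto
      ultimately have "g * m < lam S" using lamS eps a by linarith
      then show ?thesis using ex_clique_of_lam[OF SV(2) ne r] by (simp add: g_def m_def)
    qed (use cl in simp)
    obtain u v where uv: "u \<in> S" "v \<in> S" "E u v"
      "m / ?r ^ 4 * (m / ?r) ^ (r - 2) / (?r - 1) \<le> real (card {Q \<in> cliques S (r + 1). u \<in> Q \<and> v \<in> Q})"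
      using joint_of_min_degree[OF SV(2) r clS deg] unfolding m_def by blast
    have eqr: "r - 1 = Suc (r - 2)" using r by simp
    have "m / ?r ^ 4 * (m / ?r) ^ (r - 2) / (?r - 1) = m ^ (r - 1) / (?r ^ 4 * ?r ^ (r - 2) * (?r - 1))"
      unfolding eqr by (simp add: power_divide)
    also have "?r ^ 4 * ?r ^ (r - 2) = ?r ^ (r + 2)"
    proof -
      have "4 + (r - 2) = r + 2" using r by simp
      then show ?thesis by (simp only: power_add[symmetric])
    qed
    finally have tm: "m ^ (r - 1) / (?r ^ (r + 2) * (?r - 1)) \<le> t" using uv(4) tS[OF uv(1-3)] by simp
    \<comment> \<open>The loss 2^(r - 1) from m \<ge> n/2 and the divisor r - 1 of the greedy count
      fit into the second factor of r^(2r + 4) = r^(r + 2) r^(r + 2).\<close>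
    have "2 ^ (r - 1) * (?r - 1) < ?r ^ (r - 1) * ?r" using pw[of "r - 1"] r2
      by (intro mult_le_less_imp_less) auto
    also have "\<dots> \<le> ?r ^ r * ?r ^ 2"
    proof -
      have "?r ^ (r - 1) * ?r = ?r ^ r" using r by (intro power_minus_mult) simp
      then show ?thesis using r2 pw[of 2] by simp
    qed
    finally have "2 ^ (r - 1) * (?r - 1) * ?r ^ (r + 2) < ?r ^ r * ?r ^ 2 * ?r ^ (r + 2)"
      using r2 by (intro mult_strict_right_mono) auto
    then have "?n ^ (r - 1) / (?r ^ r * ?r ^ 2 * ?r ^ (r + 2)) < ?n ^ (r - 1) / (2 ^ (r - 1) * (?r - 1) * ?r ^ (r + 2))"
      using npos r2 by (intro divide_strict_left_mono) auto
    also have "\<dots> = (?n / 2) ^ (r - 1) / (?r ^ (r + 2) * (?r - 1))"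
      unfolding half by (simp add: mult_ac)
    also have "\<dots> \<le> m ^ (r - 1) / (?r ^ (r + 2) * (?r - 1))"
      using mn npos r2 by (intro divide_right_mono power_mono) auto
    also have "\<dots> \<le> t" by (rule tm)
    finally show ?thesis unfolding split by (simp add: mult_ac)
  qed
qed

end

section \<open>From clique counts to joints\<close>

text \<open>A subgraph shares the tail and head functions of \<open>G\<close>, so it is determined
  by its vertex and arc sets.\<close>

lemma finite_k_cliques:
  assumes "graph G"
  shows "finite (k_cliques k G)"
proof -
  interpret graph G by fact
  have "inj_on (\<lambda>H. (verts H, arcs H)) (k_cliques k G)"
    by (rule inj_onI) (auto simp: k_cliques_def subgraph_def compatible_def intro: pre_digraph.equality)
  moreover have "(\<lambda>H. (verts H, arcs H)) ` k_cliques k G \<subseteq> Pow (verts G) \<times> Pow (arcs G)"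
    by (auto simp: k_cliques_def subgraph_def)
  ultimately show ?thesis by (rule inj_on_finite) simp
qed

lemma induce_clique:
  assumes "graph G" "Q \<in> adjacency.cliques (dominates G) (verts G) k"
  shows "induce_subgraph G Q \<in> k_cliques k G"
proof -
  interpret graph G by fact
  interpret adjacency "dominates G" by (rule adjacency_graph[OF assms(1)])
  have Q: "Q \<subseteq> verts G" "card Q = k" "\<And>u v. u \<in> Q \<Longrightarrow> v \<in> Q \<Longrightarrow> u \<noteq> v \<Longrightarrow> dominates G u v"
    using assms(2) by (auto simp: cliques_def)
  have ind: "induced_subgraph (induce_subgraph G Q) G" by (rule induced_induce[OF Q(1)])
  interpret D: digraph "induce_subgraph G Q" by (rule digraphI_induced[OF ind])
  interpret Y: sym_digraph "induce_subgraph G Q" by (rule induced_graph_imp_graph[OF ind])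
  have gr: "graph (induce_subgraph G Q)" by unfold_locales
  have "arcs_ends (induce_subgraph G Q) = {(u, v). (u, v) \<in> Q \<times> Q \<and> u \<noteq> v}"
    using Q(3) irrefl by (auto simp: arcs_ends_conv)
  then show ?thesis using ind gr Q(2)
    by (simp add: k_cliques_def complete_digraph_def induced_subgraph_def)
qed

text \<open>Different vertex sets induce different subgraphs, so the induced cliques form a joint
  with as many members as there are vertex sets. To compare it with \<open>Sup\<close> on the
  naturals, the joint sizes must be bounded; the finite number of all k-cliques bounds them.\<close>

lemma card_cliques_le_js:
  assumes "graph G" "dominates G u v"
  shows "card {Q \<in> adjacency.cliques (dominates G) (verts G) k. u \<in> Q \<and> v \<in> Q} \<le> js k G"
proof -
  let ?X = "{Q \<in> adjacency.cliques (dominates G) (verts G) k. u \<in> Q \<and> v \<in> Q}"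
  let ?C = "induce_subgraph G ` ?X"
  obtain e where e: "e \<in> arcs G" "tail G e = u" "head G e = v"
    using assms(2) by (auto simp: arcs_ends_conv)
  have "k_joint k G ?C"
    unfolding k_joint_def using induce_clique[OF assms(1)] e by (auto intro!: bexI[of _ e])
  moreover have "card ?C = card ?X"
    by (intro card_image inj_onI) (metis induce_subgraph_verts)
  moreover have "bdd_above {card C | C. k_joint k G C}"
    by (rule bdd_aboveI[of _ "card (k_cliques k G)"])
      (auto simp: k_joint_def intro!: card_mono finite_k_cliques[OF assms(1)])
  ultimately show ?thesis unfolding js_def by (intro cSup_upper CollectI exI[of _ ?C]) auto
qed

theorem theorem1:
  fixes G :: "('a, 'b) pre_digraph" and r n :: nat
  assumes "r \<ge> 2"
    and "n > r ^ 15"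
    and "graph G"
    and "card (verts G) = n"
    and "mu G > mu (turan_graph r n)"
  shows "real (js (r + 1) G) > real n ^ (r - 1) / real r ^ (2 * r + 4)"
proof -
  interpret graph G by fact
  interpret adjacency "dominates G" by (rule adjacency_graph[OF assms(3)])
  have n: "0 < n" "0 < r" using assms by auto
  then have ne: "verts G \<noteq> {}" using assms(4) by auto
  have lower: "mu (turan_graph r n) \<ge> (1 - 1 / real r) * real n - real r / (4 * real n)"
    by (rule mu_turan_graph_ge[OF n(2,1)])
  have pos: "0 < mu (turan_graph r n)"
  proof -
    have "real r ^ 1 \<le> real r ^ 15" using assms(1) by (intro power_increasing) auto
    also have "\<dots> < real n" using assms(2) by (metis of_nat_less_iff of_nat_power)
    finally have "real r < real n" by simp
    then have "real r / (4 * real n) < 1 / 4" using n by (simp add: field_simps)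
    moreover have "1/2 * 2 \<le> (1 - 1 / real r) * real n"
      using assms(1) \<open>real r < real n\<close> by (intro mult_mono) (auto simp: field_simps)
    ultimately show ?thesis using lower by linarith
  qed
  have lam: "lam (verts G) > mu (turan_graph r n)"
    using mu_eq_lam[OF assms(3) ne] assms(5) by simp
  \<comment> \<open>The exact comparison with the Turan value is spent here;
    \<open>large_joint\<close> receives the estimate \<open>lower\<close> in its place.\<close>
  have "cliques (verts G) (r + 1) \<noteq> {}"
    using spectral_Turan[OF finite_verts assms(4) n pos] lam by fastforce
  then show ?thesis
    using lam lower card_cliques_le_js[OF assms(3)]
    by (intro large_joint[OF finite_verts assms(4,1,2)]) auto
qed

end
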